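(* Let $X$ be the Markov process on $\mathbb{Z}_+^N$ associated with the proportional fair allocation $\phi=\phi^{PF}$, with arrival rates $\lambda\in\mathrm{int}(\mathcal{C})$. For $\delta>0$ let $$G(x)=\exp(\delta F(x)),\qquad F(x)=\left(\sum_{i=1}^N\frac{x_i^2}{\lambda_i}\right)^{1/2}.$$ Then there exist constants $\delta>0$, $\gamma>0$ and $K$ such that for all $x\in\mathbb{Z}_+^N$ with $|x|>K$, $$\Delta G(x)\le-\gamma\,G(x),$$ where $\Delta$ is the generator of $X$. Hence there exist constants $K_1,K_2>0$ such that for all $x\in\mathbb{Z}_+^N$ and $t\ge0$, $$\left|P^0_t(x)-\pi^{PF}(x)\right|\le K_1e^{-K_2t},$$ where $P^0_t(x)=\mathbb{P}(X_t=x\mid X_0=0)$ and $\pi^{PF}$ is the stationary distribution of $X$.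
   Context: $N\ge 1$; $e_i$ is the $i$-th unit vector; $|x|=\sum_i|x_i|$. The capacity set $\mathcal{C}\subset\mathbb{R}_+^N$ is a compact convex set containing $\{\eta\in\mathbb{R}_+^N:\sum_i\eta_i\le c\}$ for some $c>0$. Proportional fair allocation: for $x\ne0$, $\phi^{PF}(x)=\arg\max_{\eta\in\mathcal{C}}\sum_{i:x_i>0}x_i\log\eta_i$ (coordinates with $x_i>0$ are uniquely determined; $\phi^{PF}_i(x)=0$ if $x_i=0$). The process associated with $\phi$ is the continuous-time Markov process on $\mathbb{Z}_+^N$ with transition rates $q(x,x+e_i)=\lambda_i$, $q(x,x-e_i)=\phi_i(x)$, and its generator is $$\Delta f(x)=\sum_{i=1}^N\lambda_i\left(f(x+e_i)-f(x)\right)+\phi_i(x)\left(f(x-e_i)-f(x)\right).$$ *)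

theory Defs
  imports "HOL-Probability.Probability"
begin

definition capacity_set :: "(real ^ 'n) set \<Rightarrow> bool" where
  "capacity_set C \<longleftrightarrow>
     compact C \<and> convex C \<and> (\<forall>\<eta>\<in>C. \<forall>i. 0 \<le> \<eta> $ i) \<and>
     (\<exists>c>0. {\<eta>. (\<forall>i. 0 \<le> \<eta> $ i) \<and> (\<Sum>i\<in>UNIV. \<eta> $ i) \<le> c} \<subseteq> C)"

(* In HOL "ln 0 = 0", which would spoil the maximization below; here log 0 is minus infinity. *)
definition elog :: "real \<Rightarrow> ereal" where
  "elog r = (if 0 < r then ereal (ln r) else - \<infinity>)"

definition pf_objective :: "nat ^ 'n \<Rightarrow> real ^ 'n \<Rightarrow> ereal" where
  "pf_objective x \<eta> = (\<Sum>i | 0 < x $ i. ereal (real (x $ i)) * elog (\<eta> $ i))"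

(* The maximizer is unique only in the coordinates with "x $ i > 0"; the coordinates that depend
   on the choice made by arg_max are overwritten by 0. *)
definition pf_alloc :: "(real ^ 'n) set \<Rightarrow> nat ^ 'n \<Rightarrow> real ^ 'n" where
  "pf_alloc C x =
     (\<chi> i. if x $ i = 0 then 0 else arg_max (pf_objective x) (\<lambda>\<eta>. \<eta> \<in> C) $ i)"

(* States are vectors of naturals, the i-th unit vector being "axis i 1". Subtraction is truncated:
   if "x $ i = 0" then "x - axis i 1 = x", which is harmless for allocations with "\<phi> x $ i = 0". *)
definition generator ::
    "real ^ 'n \<Rightarrow> (nat ^ 'n \<Rightarrow> real ^ 'n) \<Rightarrow> (nat ^ 'n \<Rightarrow> real) \<Rightarrow> nat ^ 'n \<Rightarrow> real" where
  "generator lam \<phi> f x =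
     (\<Sum>i\<in>UNIV. lam $ i * (f (x + axis i 1) - f x) + \<phi> x $ i * (f (x - axis i 1) - f x))"

(* Off-diagonal transition rates q x y (used only for "x \<noteq> y"). The possible targets are pairwise
   distinct, so at most one summand is nonzero. *)
definition network_rate ::
    "real ^ 'n \<Rightarrow> (nat ^ 'n \<Rightarrow> real ^ 'n) \<Rightarrow> nat ^ 'n \<Rightarrow> nat ^ 'n \<Rightarrow> real" where
  "network_rate lam \<phi> x y =
     (\<Sum>i\<in>UNIV. (if y = x + axis i 1 then lam $ i else 0) +
                 (if 0 < x $ i \<and> y = x - axis i 1 then \<phi> x $ i else 0))"

definition F_fun :: "real ^ 'n \<Rightarrow> nat ^ 'n \<Rightarrow> real" where
  "F_fun lam x = sqrt (\<Sum>i\<in>UNIV. (real (x $ i))\<^sup>2 / lam $ i)"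

definition G_fun :: "real ^ 'n \<Rightarrow> real \<Rightarrow> nat ^ 'n \<Rightarrow> real" where
  "G_fun lam \<delta> x = exp (\<delta> * F_fun lam x)"

(* A time-homogeneous Markov process as a family of laws: P x is the law of the process started
   in x, so that "trans_prob P X t x y" is the probability of X_t = y given X_0 = x. *)
definition trans_prob ::
    "('s \<Rightarrow> 'w measure) \<Rightarrow> (real \<Rightarrow> 'w \<Rightarrow> 's) \<Rightarrow> real \<Rightarrow> 's \<Rightarrow> 's \<Rightarrow> real" where
  "trans_prob P X t x y = \<P>(\<omega> in P x. X t \<omega> = y)"

(* The last two assumptions say that the derivative at 0 of the transition function is the
   conservative Q-matrix with off-diagonal entries q. *)
locale continuous_time_markov_process =
  fixes P :: "'s::countable \<Rightarrow> 'w measure"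
    and X :: "real \<Rightarrow> 'w \<Rightarrow> 's"
    and q :: "'s \<Rightarrow> 's \<Rightarrow> real"
  assumes prob_space_law: "\<And>x. prob_space (P x)"
    and measurable_state: "\<And>x t. 0 \<le> t \<Longrightarrow> X t \<in> P x \<rightarrow>\<^sub>M count_space UNIV"
    and initial_state: "\<And>x. trans_prob P X 0 x x = 1"
    and markov_property: "\<And>x s t J z y w.
          0 \<le> s \<Longrightarrow> 0 \<le> t \<Longrightarrow> finite J \<Longrightarrow> J \<subseteq> {0..s} \<Longrightarrow>
          \<P>(\<omega> in P x. (\<forall>r\<in>J. X r \<omega> = z r) \<and> X s \<omega> = y \<and> X (s + t) \<omega> = w) =
          \<P>(\<omega> in P x. (\<forall>r\<in>J. X r \<omega> = z r) \<and> X s \<omega> = y) * trans_prob P X t y w"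
    and jump_rate: "\<And>x y. x \<noteq> y \<Longrightarrow>
          ((\<lambda>h. trans_prob P X h x y / h) \<longlongrightarrow> q x y) (at_right 0)"
    and exit_rate: "\<And>x.
          ((\<lambda>h. (1 - trans_prob P X h x x) / h) \<longlongrightarrow> (\<Sum>\<^sub>\<infinity>y\<in>-{x}. q x y)) (at_right 0)"

definition stationary_distribution ::
    "('s \<Rightarrow> 'w measure) \<Rightarrow> (real \<Rightarrow> 'w \<Rightarrow> 's) \<Rightarrow> ('s \<Rightarrow> real) \<Rightarrow> bool" where
  "stationary_distribution P X \<pi> \<longleftrightarrow>
     (\<forall>x. 0 \<le> \<pi> x) \<and> (\<pi> has_sum 1) UNIV \<and>
     (\<forall>t\<ge>0. \<forall>y. ((\<lambda>x. \<pi> x * trans_prob P X t x y) has_sum \<pi> y) UNIV)"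

end

theory Submission
  imports Defs "HOL-Real_Asymp.Real_Asymp"
begin

text \<open>Comparing the proportionally fair allocation \<open>\<phi>\<close> with the feasible point \<open>(1 + \<epsilon>) \<lambda>\<close> by first
  order optimality gives \<open>(1 + \<epsilon>) \<bar>x\<bar> \<le> (\<Sum>i. x i \<phi> i / \<lambda> i)\<close> (\<open>pf_first_order\<close>,
  \<open>stable_network_pf_alloc\<close>). The right-hand side minus \<open>\<bar>x\<bar>\<close> is the leading term of the downward drift of
  \<open>F\<^sup>2 / 2\<close>. Hence \<open>F\<close> itself drifts down at a rate bounded away from zero far from the origin. As the
  jumps of \<open>F\<close> are bounded, a second order expansion turns this into \<open>\<Delta> G \<le> - \<gamma> G\<close> for a small exponent
  \<open>\<delta>\<close> (\<open>exponential_drift\<close>).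

  For the convergence to equilibrium, two copies of the process run independently until both are empty.
  Adding a bounded correction to \<open>G x + G y\<close> yields a function \<open>D\<close> of the pair with generator bound
  \<open>- \<kappa> D\<close> everywhere except at \<open>(0, 0)\<close> (\<open>pair_lyapunov_function\<close>). The difference of the
  probabilities of \<open>X t \<in> A\<close> under the starting points \<open>x\<close> and \<open>y\<close> solves the backward equation of
  the pair and vanishes at \<open>(0, 0)\<close>. A minimum principle therefore bounds it by \<open>exp (- \<kappa> t) D x y\<close>
  (\<open>prob_in_coupling_bound\<close>).

  Applied to the empty state and its neighbours, this bound makes the time derivative of the law of
  \<open>X t\<close> started empty decay exponentially, uniformly over events. So the law converges exponentially
  fast, without loss of mass, to the unique stationary distribution (\<open>exponential_ergodicity\<close>).\<close>

section \<open>A minimum principle in time\<close>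

text \<open>If a value were negative, it would stay so after adding \<open>\<epsilon> (1 + t)\<close> for a small \<open>\<epsilon>\<close>. At the first
  time at which the perturbed function vanishes somewhere, that zero is a global spatial minimum, so its
  time derivative is at least \<open>\<epsilon>\<close>, whereas the function was positive just before. Outside the finite set \<open>E\<close> no zero can occur,
  which is what makes a first time exist.\<close>

lemma minimum_principle:
  fixes w :: "real \<Rightarrow> 'a \<Rightarrow> real"
  assumes fin: "finite E"
    and cont: "\<And>a. a \<in> E \<Longrightarrow> continuous_on {0..T} (\<lambda>t. w t a)"
    and init: "\<And>a. a \<in> E \<Longrightarrow> 0 \<le> w 0 a"
    and out: "\<And>t a. \<lbrakk>0 \<le> t; t \<le> T; a \<notin> E\<rbrakk> \<Longrightarrow> 0 \<le> w t a"
    and deriv: "\<And>t a. \<lbrakk>0 < t; t \<le> T; a \<in> E; \<And>b. w t a \<le> w t b\<rbrakk> \<Longrightarrow>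
                  \<exists>d\<ge>0. ((\<lambda>s. w s a) has_real_derivative d) (at t)"
    and t: "0 \<le> t" "t \<le> T"
  shows "0 \<le> w t a"
proof (rule ccontr)
  assume neg: "\<not> 0 \<le> w t a"
  \<comment> \<open>Small enough for the perturbation to stay negative at the assumed bad point.\<close>
  define \<epsilon> where "\<epsilon> = - w t a / (2 * (1 + t))"
  have \<epsilon>: "0 < \<epsilon>" using neg t by (simp add: \<epsilon>_def field_simps)
  define v where "v s b = w s b + \<epsilon> * (1 + s)" for s b
  have "v t a = w t a / 2" using t by (simp add: v_def \<epsilon>_def field_simps)
  hence vneg: "v t a < 0" using neg by simp
  have aE: "a \<in> E" using neg out t by blast
  define B where "B = (\<Union>b\<in>E. {s\<in>{0..T}. v s b \<le> 0})"
  have contv: "continuous_on {0..T} (\<lambda>s. v s b)" if "b \<in> E" for b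
    unfolding v_def by (intro continuous_intros cont that)
  have "closed {s\<in>{0..T}. v s b \<le> 0}" if "b \<in> E" for b
    by (rule continuous_on_closed_Collect_le[OF contv[OF that] continuous_on_const]) simp
  hence "compact {s\<in>{0..T}. v s b \<le> 0}" if "b \<in> E" for b
    using that by (auto simp: compact_eq_bounded_closed intro: bounded_subset[OF bounded_closed_interval[of 0 T]])
  hence "compact B" unfolding B_def using fin by (intro compact_UN) auto
  moreover have "t \<in> B" using vneg aE t by (auto simp: B_def intro!: bexI[of _ a])
  ultimately obtain t0 where t0: "t0 \<in> B" and first: "\<And>s. s \<in> B \<Longrightarrow> t0 \<le> s"
    using compact_attains_inf[of B] by blast
  obtain b where b: "b \<in> E" "0 \<le> t0" "t0 \<le> T" "v t0 b \<le> 0" using t0 by (auto simp: B_def)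
  have "t0 \<noteq> 0" using b init[of b] \<epsilon> by (auto simp: v_def)
  hence pos0: "0 < t0" using b by simp
  have before: "0 < v s c" if "c \<in> E" "0 \<le> s" "s < t0" for s c
    using first[of s] that b by (fastforce simp: B_def)
  have ge: "0 \<le> v t0 c" if c: "c \<in> E" for c
  proof (rule tendsto_lowerbound)
    have "continuous (at t0 within {0..t0}) (\<lambda>s. v s c)"
      using continuous_on_subset[OF contv[OF c], of "{0..t0}"] b by (auto simp: continuous_on_eq_continuous_within)
    thus "((\<lambda>s. v s c) \<longlongrightarrow> v t0 c) (at_left t0)"
      using pos0 by (simp add: continuous_within at_within_Icc_at_left)
    show "\<forall>\<^sub>F s in at_left t0. 0 \<le> v s c"
      using pos0 before[OF c] by (auto intro!: eventually_at_leftI[of 0] less_imp_le)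
  qed simp
  have wv: "w t0 c = v t0 c - \<epsilon> * (1 + t0)" for c by (simp add: v_def)
  have vb: "v t0 b = 0" using ge b by force
  have "w t0 b \<le> w t0 c" for c
  proof (cases "c \<in> E")
    case True thus ?thesis using ge vb by (simp add: wv)
  next
    case False
    hence "0 \<le> w t0 c" using out b by simp
    thus ?thesis using vb wv[of b] \<epsilon> pos0 by (smt (verit) mult_nonneg_nonneg)
  qed
  then obtain d where d: "d \<ge> 0" "((\<lambda>s. w s b) has_real_derivative d) (at t0)"
    using deriv[of t0 b] pos0 b by blast
  have "((\<lambda>s. v s b) has_real_derivative d + \<epsilon>) (at t0)"
    unfolding v_def by (auto intro!: derivative_eq_intros d)
  from DERIV_pos_inc_left[OF this] d \<epsilon> obtain r where
    r: "r > 0" "\<And>h. 0 < h \<Longrightarrow> h < r \<Longrightarrow> v (t0 - h) b < v t0 b" by auto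
  \<comment> \<open>Half a step, so that the earlier time is within reach of the derivative and still positive.\<close>
  define h where "h = min r t0 / 2"
  have "v (t0 - h) b < 0" using r(2)[of h] r(1) pos0 vb by (simp add: h_def)
  moreover have "0 < v (t0 - h) b" using before b r pos0 by (simp add: h_def)
  ultimately show False by simp
qed

section \<open>Discrete distributions\<close>

text \<open>Two mass functions both sum to one, so a pointwise inequality cannot be strict anywhere. This
  turns Fatou-type inequalities into equations.\<close>

lemma pmf_eqI_le: "(\<And>x. pmf M x \<le> pmf N x) \<Longrightarrow> M = N"
  using pmf_neq_exists_less[of N M] by (metis not_less)

lemma integrable_pmf_bounded:
  fixes f :: "'a \<Rightarrow> real"
  assumes "\<And>y. \<bar>f y\<bar> \<le> B"
  shows "integrable (measure_pmf M) f"
  by (rule measure_pmf.integrable_const_bound[of _ B]) (auto simp: assms)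

lemma has_sum_pmf_expectation:
  fixes f :: "'a \<Rightarrow> real"
  assumes "\<And>x. \<bar>f x\<bar> \<le> B"
  shows "((\<lambda>x. pmf M x * f x) has_sum measure_pmf.expectation M f) UNIV"
proof -
  have "integrable (density (count_space UNIV) (pmf M)) f"
    using integrable_pmf_bounded[of f B M] assms by (simp add: measure_pmf_eq_density)
  hence "integrable (count_space UNIV) (\<lambda>x. pmf M x * f x)"
    by (subst (asm) integrable_density) auto
  hence summ: "Infinite_Set_Sum.abs_summable_on (\<lambda>x. pmf M x * f x) UNIV"
    by (simp add: abs_summable_on_def)
  have "measure_pmf.expectation M f = infsetsum (\<lambda>x. pmf M x * f x) UNIV"
    by (rule pmf_expectation_eq_infsetsum)
  also have "\<dots> = infsum (\<lambda>x. pmf M x * f x) UNIV"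
    by (rule infsetsum_infsum[OF summ])
  finally show ?thesis
    using summ by (metis abs_summable_equivalent abs_summable_summable has_sum_infsum)
qed

text \<open>Finite partial sums suffice because both sides are probability distributions. The lemma is used
  for the Chapman-Kolmogorov equation and for the invariance of the limit distribution.\<close>

lemma bind_pmf_eqI:
  assumes "\<And>A y. finite A \<Longrightarrow> (\<Sum>x\<in>A. pmf M x * pmf (f x) y) \<le> pmf N y"
  shows "bind_pmf M f = N"
proof (rule pmf_eqI_le)
  fix y
  have "((\<lambda>x. pmf M x * pmf (f x) y) has_sum pmf (bind_pmf M f) y) UNIV"
    unfolding pmf_bind by (rule has_sum_pmf_expectation[of _ 1]) (simp add: pmf_le_1)
  thus "pmf (bind_pmf M f) y \<le> pmf N y"
    by (rule has_sum_le_finite_sums) (use assms in auto)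
qed

lemma ex_pmf_of_has_sum:
  fixes p :: "'a \<Rightarrow> real"
  assumes "\<And>x. 0 \<le> p x" "(p has_sum 1) UNIV"
  shows "\<exists>M. pmf M = p"
proof -
  have "Infinite_Set_Sum.abs_summable_on p UNIV" using assms
    by (subst abs_summable_equivalent[symmetric]) (simp add: has_sum_iff)
  hence "(\<integral>\<^sup>+x. ennreal (p x) \<partial>count_space UNIV) = ennreal (infsetsum p UNIV)"
    using assms by (subst nn_integral_conv_infsetsum) auto
  also have "infsetsum p UNIV = 1" using assms \<open>Infinite_Set_Sum.abs_summable_on p UNIV\<close>
    by (simp add: infsetsum_infsum has_sum_iff)
  finally have "pmf (embed_pmf p) x = p x" for x using assms by (intro pmf_embed_pmf) auto
  thus ?thesis by blast
qed

section \<open>Transition semigroup and backward equation\<close>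

text \<open>Summing over the support keeps the sum finite for nearest neighbour dynamics on an infinite state
  space.\<close>

definition jump_generator :: "('s \<Rightarrow> 's \<Rightarrow> real) \<Rightarrow> ('s \<Rightarrow> real) \<Rightarrow> 's \<Rightarrow> real" where
  "jump_generator q f x = (\<Sum>y | q x y \<noteq> 0. q x y * (f y - f x))"

context continuous_time_markov_process
begin

definition law :: "real \<Rightarrow> 's \<Rightarrow> 's pmf" where
  "law t x = Abs_pmf (distr (P x) (count_space UNIV) (X t))"

lemma measure_law:
  assumes "0 \<le> t"
  shows "measure_pmf (law t x) = distr (P x) (count_space UNIV) (X t)"
proof -
  interpret prob_space "P x" by (rule prob_space_law)
  interpret D: prob_space "distr (P x) (count_space UNIV) (X t)"
    by (rule prob_space_distr[OF measurable_state[OF assms]])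
  show ?thesis unfolding law_def
    by (rule Abs_pmf_inverse)
       (auto simp: D.prob_space_axioms D.AE_support_countable intro!: exI[of _ UNIV])
qed

lemma pmf_law:
  assumes "0 \<le> t"
  shows "pmf (law t x) y = trans_prob P X t x y"
proof -
  have "X t -` {y} \<inter> space (P x) = {\<omega> \<in> space (P x). X t \<omega> = y}" by auto
  thus ?thesis using measurable_state[OF assms, of x]
    by (simp add: pmf.rep_eq measure_law[OF assms] measure_distr trans_prob_def)
qed

lemma law_0: "law 0 x = return_pmf x"
proof (rule sym, rule pmf_eqI_le)
  show "pmf (return_pmf x) y \<le> pmf (law 0 x) y" for y
    using initial_state[of x] by (cases "y = x") (simp_all add: pmf_law trans_prob_def)
qed

lemma joint_law:
  assumes "0 \<le> s" "0 \<le> t"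
  shows "\<P>(\<omega> in P x. X s \<omega> = y \<and> X (s + t) \<omega> = w) = pmf (law s x) y * pmf (law t y) w"
  using markov_property[OF assms, of "{}" x "\<lambda>_. y" y w] assms
  by (simp add: pmf_law trans_prob_def)

lemma chapman_kolmogorov:
  assumes "0 \<le> s" "0 \<le> t"
  shows "bind_pmf (law s x) (law t) = law (s + t) x"
proof (rule bind_pmf_eqI)
  fix A :: "'s set" and w assume A: "finite A"
  interpret prob_space "P x" by (rule prob_space_law)
  have st: "0 \<le> s + t" using assms by simp
  note [measurable] = measurable_state[OF assms(1), of x] measurable_state[OF st, of x]
  have "(\<Sum>y\<in>A. pmf (law s x) y * pmf (law t y) w)
      = (\<Sum>y\<in>A. prob {\<omega>\<in>space (P x). X s \<omega> = y \<and> X (s + t) \<omega> = w})"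
    by (simp add: joint_law assms)
  also have "\<dots> = prob (\<Union>y\<in>A. {\<omega>\<in>space (P x). X s \<omega> = y \<and> X (s + t) \<omega> = w})"
    by (rule finite_measure_finite_Union[symmetric]) (auto simp: A disjoint_family_on_def)
  also have "\<dots> \<le> prob {\<omega>\<in>space (P x). X (s + t) \<omega> = w}"
    by (rule finite_measure_mono) auto
  also have "\<dots> = pmf (law (s + t) x) w"
    by (simp add: pmf_law st trans_prob_def)
  finally show "(\<Sum>y\<in>A. pmf (law s x) y * pmf (law t y) w) \<le> pmf (law (s + t) x) w" .
qed

definition prob_in :: "'s set \<Rightarrow> real \<Rightarrow> 's \<Rightarrow> real" where
  "prob_in A t x = measure_pmf.prob (law t x) A"

lemma prob_in_bounds: "0 \<le> prob_in A t x" "prob_in A t x \<le> 1"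
  by (auto simp: prob_in_def)

lemma prob_in_diff_le_1: "\<bar>prob_in A t x - prob_in B s y\<bar> \<le> 1"
  using prob_in_bounds[of A t x] prob_in_bounds[of B s y] by auto

lemma prob_in_0: "prob_in A 0 x = indicator A x"
  by (simp add: prob_in_def law_0)

lemma prob_in_add:
  assumes "0 \<le> s" "0 \<le> t"
  shows "prob_in A (s + t) x = measure_pmf.expectation (law s x) (prob_in A t)"
proof -
  have "ennreal (prob_in A (s + t) x) = (\<integral>\<^sup>+y. emeasure (law t y) A \<partial>law s x)"
    by (simp add: prob_in_def measure_pmf.emeasure_eq_measure[symmetric] chapman_kolmogorov[OF assms, symmetric])
  also have "\<dots> = (\<integral>\<^sup>+y. ennreal (prob_in A t y) \<partial>law s x)"
    by (simp add: prob_in_def measure_pmf.emeasure_eq_measure)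
  also have "\<dots> = ennreal (measure_pmf.expectation (law s x) (prob_in A t))"
    by (rule nn_integral_eq_integral) (auto intro!: integrable_pmf_bounded[of _ 1] simp: prob_in_bounds)
  finally show ?thesis
    by (simp add: prob_in_bounds integral_nonneg_AE)
qed

lemma prob_in_increment:
  assumes "0 \<le> h" "0 \<le> t"
  shows "prob_in A (h + t) x - prob_in A t x
       = measure_pmf.expectation (law h x) (\<lambda>y. prob_in A t y - prob_in A t x)"
  by (simp add: prob_in_add[OF assms] integrable_pmf_bounded[of _ 1] prob_in_bounds)

lemma stay_prob_tendsto_1: "((\<lambda>h. pmf (law h x) x) \<longlongrightarrow> 1) (at_right 0)"
proof -
  have "((\<lambda>h. 1 - h * ((1 - trans_prob P X h x x) / h)) \<longlongrightarrow> 1 - 0 * (\<Sum>\<^sub>\<infinity>y\<in>-{x}. q x y)) (at_right 0)"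
    by (intro tendsto_intros exit_rate)
  moreover have "\<forall>\<^sub>F h in at_right 0. 1 - h * ((1 - trans_prob P X h x x) / h) = pmf (law h x) x"
    by (rule eventually_at_rightI[of 0 1]) (auto simp: pmf_law)
  ultimately show ?thesis by (simp add: filterlim_cong)
qed

lemma rate_nonneg:
  assumes "x \<noteq> y" shows "0 \<le> q x y"
proof (rule tendsto_lowerbound[OF jump_rate[OF assms]])
  show "\<forall>\<^sub>F h in at_right 0. 0 \<le> trans_prob P X h x y / h"
    by (rule eventually_at_rightI[of 0 1]) (auto simp: trans_prob_def)
qed simp

lemma expectation_le_leave_prob:
  fixes f :: "'s \<Rightarrow> real"
  assumes "finite S" "\<And>y. \<bar>f y\<bar> \<le> 1" "\<And>y. y \<in> S \<Longrightarrow> f y = 0"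
  shows "\<bar>measure_pmf.expectation M f\<bar> \<le> 1 - (\<Sum>y\<in>S. pmf M y)"
proof -
  have "\<bar>measure_pmf.expectation M f\<bar> \<le> measure_pmf.expectation M (\<lambda>y. \<bar>f y\<bar>)"
    by simp
  also have "\<dots> \<le> measure_pmf.expectation M (indicator (-S))"
    using assms by (intro integral_mono integrable_pmf_bounded[of _ 1]) (auto split: split_indicator)
  also have "\<dots> = measure_pmf.prob M (-S)" by simp
  also have "\<dots> = 1 - measure_pmf.prob M S"
    using measure_pmf.prob_compl[of S M] by (simp add: Compl_eq_Diff_UNIV)
  also have "measure_pmf.prob M S = (\<Sum>y\<in>S. pmf M y)"
    using assms by (simp add: measure_measure_pmf_finite)
  finally show ?thesis .
qed

text \<open>The continuity modulus in time is governed by the probability of leaving the current state,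
  in the same way for all events.\<close>

lemma prob_in_modulus:
  assumes "0 \<le> s" "s \<le> t"
  shows "\<bar>prob_in A t x - prob_in A s x\<bar> \<le> 1 - pmf (law (t - s) x) x"
  using prob_in_increment[of "t - s" s A x] assms
    expectation_le_leave_prob[of "{x}" "\<lambda>y. prob_in A s y - prob_in A s x" "law (t - s) x"]
  by (simp add: prob_in_diff_le_1)

lemma continuous_on_prob_in: "continuous_on {0..} (\<lambda>t. prob_in A t x)"
  unfolding continuous_on_iff
proof (intro ballI allI impI)
  fix t e :: real assume t: "t \<in> {0..}" and e: "0 < e"
  have "\<forall>\<^sub>F h in at_right 0. 1 - e < pmf (law h x) x"
    using order_tendstoD(1)[OF stay_prob_tendsto_1[of x], of "1 - e"] e by simp
  then obtain d where d: "d > 0" "\<And>h. 0 < h \<Longrightarrow> h < d \<Longrightarrow> 1 - e < pmf (law h x) x"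
    unfolding eventually_at_right_field by auto
  have "dist (prob_in A s x) (prob_in A t x) < e" if s: "s \<in> {0..}" "dist s t < d" for s
  proof (cases s t rule: linorder_cases)
    case less
    thus ?thesis using prob_in_modulus[of s t A x] d(2)[of "t - s"] s by (auto simp: dist_real_def)
  next
    case greater
    thus ?thesis using prob_in_modulus[of t s A x] d(2)[of "s - t"] s t by (auto simp: dist_real_def)
  qed (use e in simp)
  thus "\<exists>d>0. \<forall>s\<in>{0..}. dist s t < d \<longrightarrow> dist (prob_in A s x) (prob_in A t x) < e"
    using d by blast
qed

text \<open>The difference quotients of the transition function converge entrywise, and the total rate of
  leaving \<open>x\<close> equals the sum over the finitely many jump targets. Hence the mass that goes elsewhere
  within time \<open>h\<close> is of smaller order than \<open>h\<close>, and bounded functions do not see it. The function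
  may vary with \<open>h\<close>, which is needed for derivatives from the left.\<close>

lemma generator_limit:
  fixes f :: "real \<Rightarrow> 's \<Rightarrow> real"
  assumes fin: "finite {y. q x y \<noteq> 0}"
    and bnd: "\<And>h y. \<bar>f h y - f h x\<bar> \<le> 1"
    and lim: "\<And>y. ((\<lambda>h. f h y) \<longlongrightarrow> g y) (at_right 0)"
  shows "((\<lambda>h. measure_pmf.expectation (law h x) (\<lambda>y. f h y - f h x) / h)
           \<longlongrightarrow> jump_generator q g x) (at_right 0)"
proof -
  define S where "S = {y. q x y \<noteq> 0} - {x}"
  have finS: "finite S" "x \<notin> S" using fin by (auto simp: S_def)
  define main where "main h = (\<Sum>y\<in>S. (f h y - f h x) * (trans_prob P X h x y / h))" for h
  \<comment> \<open>The rate at which mass reaches neither \<open>x\<close> nor any of its jump targets.\<close>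
  define err where "err h = (1 - trans_prob P X h x x) / h - (\<Sum>y\<in>S. trans_prob P X h x y / h)" for h
  have "(\<Sum>\<^sub>\<infinity>y\<in>-{x}. q x y) = (\<Sum>y\<in>S. q x y)"
    unfolding infsum_finite[OF finS(1), symmetric]
    by (rule infsum_cong_neutral) (auto simp: S_def)
  hence "(err \<longlongrightarrow> (\<Sum>y\<in>S. q x y) - (\<Sum>y\<in>S. q x y)) (at_right 0)"
    unfolding err_def using exit_rate[of x]
    by (intro tendsto_diff tendsto_sum jump_rate) (use finS in auto)
  hence err: "(err \<longlongrightarrow> 0) (at_right 0)" by simp
  have "(main \<longlongrightarrow> (\<Sum>y\<in>S. (g y - g x) * q x y)) (at_right 0)"
    unfolding main_def
    by (intro tendsto_sum tendsto_mult tendsto_diff lim jump_rate) (use finS in auto)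
  also have "(\<Sum>y\<in>S. (g y - g x) * q x y) = jump_generator q g x"
    unfolding jump_generator_def S_def
    using fin by (intro sum.mono_neutral_cong_left) auto
  finally have main: "(main \<longlongrightarrow> jump_generator q g x) (at_right 0)" .
  have bound: "\<bar>measure_pmf.expectation (law h x) (\<lambda>y. f h y - f h x) / h - main h\<bar> \<le> err h"
    if h: "0 < h" for h
  proof -
    let ?M = "law h x" and ?F = "\<lambda>y. f h y - f h x"
    have "measure_pmf.expectation ?M ?F
        = measure_pmf.expectation ?M (\<lambda>y. ?F y * indicator S y + ?F y * indicator (-S) y)"
      by (intro Bochner_Integration.integral_cong) (auto split: split_indicator)
    also have "\<dots> = measure_pmf.expectation ?M (\<lambda>y. ?F y * indicator S y)
                 + measure_pmf.expectation ?M (\<lambda>y. ?F y * indicator (-S) y)"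
      by (intro Bochner_Integration.integral_add integrable_pmf_bounded[of _ 1])
         (use bnd in \<open>auto split: split_indicator\<close>)
    also have "measure_pmf.expectation ?M (\<lambda>y. ?F y * indicator S y)
             = (\<Sum>y\<in>S. ?F y * indicator S y * pmf ?M y)"
      using finS by (intro integral_measure_pmf_real) (auto split: split_indicator_asm)
    also have "\<dots> = h * main h"
      using h by (simp add: main_def sum_distrib_left pmf_law)
    finally have eq: "measure_pmf.expectation ?M ?F
       = h * main h + measure_pmf.expectation ?M (\<lambda>y. ?F y * indicator (-S) y)" .
    have "\<bar>measure_pmf.expectation ?M (\<lambda>y. ?F y * indicator (-S) y)\<bar> \<le> 1 - (\<Sum>y\<in>insert x S. pmf ?M y)"
      by (rule expectation_le_leave_prob) (use bnd finS in \<open>auto split: split_indicator\<close>)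
    also have "\<dots> = h * err h"
      using h finS by (simp add: err_def pmf_law right_diff_distrib diff_divide_distrib sum_distrib_left)
    finally have "\<bar>measure_pmf.expectation ?M (\<lambda>y. ?F y * indicator (-S) y)\<bar> \<le> h * err h" .
    thus ?thesis using h eq by (simp add: abs_le_iff field_simps)
  qed
  have "((\<lambda>h. measure_pmf.expectation (law h x) (\<lambda>y. f h y - f h x) / h - main h) \<longlongrightarrow> 0) (at_right 0)"
    by (rule Lim_null_comparison[OF _ err])
       (use bound in \<open>auto intro!: eventually_at_rightI[of 0 1]\<close>)
  from tendsto_add[OF this main] show ?thesis by simp
qed

text \<open>Both one-sided difference quotients come from conditioning on the first \<open>h\<close> units of time: from
  \<open>t\<close> to \<open>t + h\<close> on the right, and from \<open>t - h\<close> to \<open>t\<close> on the left.\<close>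

lemma backward_equation:
  assumes fin: "finite {y. q x y \<noteq> 0}" and t: "0 < t"
  shows "((\<lambda>s. prob_in A s x) has_real_derivative jump_generator q (prob_in A t) x) (at t)"
proof -
  have right: "((\<lambda>h. (prob_in A (t + h) x - prob_in A t x) / h) \<longlongrightarrow> jump_generator q (prob_in A t) x) (at_right 0)"
  proof (rule Lim_transform_eventually[OF generator_limit[OF fin, of "\<lambda>_. prob_in A t" "prob_in A t"]])
    show "\<forall>\<^sub>F h in at_right 0. measure_pmf.expectation (law h x) (\<lambda>y. prob_in A t y - prob_in A t x) / h
            = (prob_in A (t + h) x - prob_in A t x) / h"
      using t by (auto intro!: eventually_at_rightI[of 0 1] simp flip: prob_in_increment simp: add.commute)
  qed (auto simp: prob_in_diff_le_1)
  have lim: "((\<lambda>h. prob_in A (t - h) y) \<longlongrightarrow> prob_in A t y) (at_right 0)" for y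
  proof -
    have "isCont (\<lambda>s. prob_in A s y) t"
      using continuous_on_interior[OF continuous_on_prob_in[of A y]] t by simp
    moreover have "((\<lambda>h. t - h) \<longlongrightarrow> t - 0) (at_right (0::real))" by (intro tendsto_intros)
    ultimately show ?thesis
      using isCont_tendsto_compose[of t "\<lambda>s. prob_in A s y" "\<lambda>h. t - h"] by simp
  qed
  have left: "((\<lambda>h. (prob_in A t x - prob_in A (t - h) x) / h) \<longlongrightarrow> jump_generator q (prob_in A t) x) (at_right 0)"
  proof (rule Lim_transform_eventually[OF generator_limit[OF fin, of "\<lambda>h. prob_in A (t - h)" "prob_in A t"]])
    show "\<forall>\<^sub>F h in at_right 0. measure_pmf.expectation (law h x) (\<lambda>y. prob_in A (t - h) y - prob_in A (t - h) x) / h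
            = (prob_in A t x - prob_in A (t - h) x) / h"
      using t by (auto intro!: eventually_at_rightI[of 0 t] simp flip: prob_in_increment)
  qed (auto simp: prob_in_diff_le_1 lim)
  have "(a - b) / - h = (b - a) / h" for a b h :: real
    by (simp add: minus_divide_left)
  thus ?thesis
    unfolding DERIV_def filterlim_at_split
    using right left by (simp add: filterlim_at_left_to_right)
qed

end

section \<open>Exponential ergodicity from a Lyapunov function on pairs\<close>

lemma jump_generator_diff:
  "jump_generator q (\<lambda>x. a * f x - g x) x = a * jump_generator q f x - jump_generator q g x"
  unfolding jump_generator_def sum_distrib_left sum_subtractf[symmetric]
  by (intro sum.cong refl) (simp add: algebra_simps)

lemma jump_generator_add_const:
  "jump_generator q (\<lambda>x. f x + c) x = jump_generator q f x"
  by (simp add: jump_generator_def)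

context continuous_time_markov_process
begin

lemma jump_generator_nonneg_at_minimum:
  assumes "\<And>y. f x \<le> f y"
  shows "0 \<le> jump_generator q f x"
  unfolding jump_generator_def
proof (rule sum_nonneg)
  fix y show "0 \<le> q x y * (f y - f x)"
    using rate_nonneg[of x y] assms[of y] by (cases "x = y") auto
qed

lemma prob_in_compl: "prob_in (- A) t x = 1 - prob_in A t x"
  unfolding prob_in_def using measure_pmf.prob_compl[of A "law t x"] by (simp add: Compl_eq_Diff_UNIV)

lemma prob_in_singleton: "prob_in {y} t x = pmf (law t x) y"
  by (simp add: prob_in_def pmf.rep_eq)

text \<open>Here \<open>D\<close> is a Lyapunov function for two independent copies of the process, killed when both are in
  the state \<open>z\<close>. The function \<open>exp (- \<kappa> t) D x y\<close> is a supersolution of the backward equation of the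
  pair, while the difference of the two probabilities is a solution. It starts below the
  supersolution and vanishes at \<open>(z, z)\<close>, so the minimum principle keeps it below for all times. The
  exceptional set is finite because \<open>D\<close> has finite sublevel sets and probabilities are bounded.\<close>

lemma prob_in_coupling_bound:
  fixes D :: "'s \<Rightarrow> 's \<Rightarrow> real"
  assumes fin: "\<And>x. finite {y. q x y \<noteq> 0}"
    and D_nonneg: "\<And>x y. 0 \<le> D x y"
    and D_ge_1: "\<And>x y. x \<noteq> y \<Longrightarrow> 1 \<le> D x y"
    and sublevel: "\<And>r. finite {(x, y). D x y \<le> r}"
    and drift: "\<And>x y. (x, y) \<noteq> (z, z) \<Longrightarrow>
        jump_generator q (\<lambda>x'. D x' y) x + jump_generator q (\<lambda>y'. D x y') y \<le> - \<kappa> * D x y"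
    and \<kappa>: "0 < \<kappa>" and t: "0 \<le> t"
  shows "\<bar>prob_in A t x - prob_in A t y\<bar> \<le> exp (- \<kappa> * t) * D x y"
proof -
  have one_sided: "prob_in A t x - prob_in A t y \<le> exp (- \<kappa> * t) * D x y" for A
  proof -
    define w where "w s p = exp (- \<kappa> * s) * D (fst p) (snd p) - (prob_in A s (fst p) - prob_in A s (snd p))"
      for s p
    define E where "E = {(x, y). D x y \<le> exp (\<kappa> * t)} - {(z, z)}"
    have "0 \<le> w t (x, y)"
    proof (rule minimum_principle[where w = w and E = E and T = t])
      show "finite E" using sublevel by (simp add: E_def)
      show "continuous_on {0..t} (\<lambda>s. w s p)" for p
        unfolding w_def
        by (intro continuous_intros continuous_on_subset[OF continuous_on_prob_in]) auto
      show "0 \<le> w 0 p" for p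
        using D_nonneg[of "fst p" "snd p"] D_ge_1[of "fst p" "snd p"]
        by (cases "fst p = snd p") (auto simp: w_def prob_in_0 split: split_indicator)
      show "0 \<le> w s p" if s: "0 \<le> s" "s \<le> t" and p: "p \<notin> E" for s p
      proof (cases "p = (z, z)")
        case True thus ?thesis using D_nonneg by (simp add: w_def)
      next
        case False
        hence "exp (\<kappa> * t) < D (fst p) (snd p)" using p by (cases p) (auto simp: E_def)
        moreover have "\<kappa> * s \<le> \<kappa> * t" using s \<kappa> by simp
        ultimately have "exp (- \<kappa> * s) * exp (\<kappa> * s) \<le> exp (- \<kappa> * s) * D (fst p) (snd p)"
          by (intro mult_left_mono) (auto intro: order_trans[of _ "exp (\<kappa> * t)"])
        hence "1 \<le> exp (- \<kappa> * s) * D (fst p) (snd p)" by (simp add: mult_exp_exp)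
        thus ?thesis using prob_in_diff_le_1[of A s "fst p" A s "snd p"] by (simp add: w_def)
      qed
      show "\<exists>d\<ge>0. ((\<lambda>s. w s p) has_real_derivative d) (at s)"
        if s: "0 < s" "s \<le> t" and p: "p \<in> E" and min: "\<And>b. w s p \<le> w s b" for s p
      proof -
        obtain x y where xy: "p = (x, y)" by (cases p)
        define a where "a = exp (- \<kappa> * s)"
        define d where "d = a * (- \<kappa> * D x y)
          - (jump_generator q (prob_in A s) x - jump_generator q (prob_in A s) y)"
        have "((\<lambda>s. w s p) has_real_derivative d) (at s)"
          unfolding w_def d_def a_def xy fst_conv snd_conv
          by (auto intro!: derivative_eq_intros backward_equation fin s)
        moreover have "0 \<le> d"
        proof -
          \<comment> \<open>A global minimum of \<open>w s\<close> is a minimum in each of the two coordinates.\<close>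
          have "0 \<le> jump_generator q (\<lambda>x'. w s (x', y)) x + jump_generator q (\<lambda>y'. w s (x, y')) y"
            by (intro add_nonneg_nonneg jump_generator_nonneg_at_minimum) (use min in \<open>auto simp: xy\<close>)
          also have "(\<lambda>x'. w s (x', y)) = (\<lambda>x'. (a * D x' y - prob_in A s x') + prob_in A s y)"
            by (simp add: w_def a_def fun_eq_iff)
          also have "(\<lambda>y'. w s (x, y')) = (\<lambda>y'. (a * D x y' - (-1 * prob_in A s y' - 0)) + (- prob_in A s x))"
            by (simp add: w_def a_def fun_eq_iff)
          also have "jump_generator q (\<lambda>x'. (a * D x' y - prob_in A s x') + prob_in A s y) x
             + jump_generator q (\<lambda>y'. (a * D x y' - (-1 * prob_in A s y' - 0)) + (- prob_in A s x)) y
             = a * (jump_generator q (\<lambda>x'. D x' y) x + jump_generator q (\<lambda>y'. D x y') y)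
              - (jump_generator q (prob_in A s) x - jump_generator q (prob_in A s) y)"
            unfolding jump_generator_add_const jump_generator_diff
            by (simp add: jump_generator_def algebra_simps)
          also have "\<dots> \<le> d" unfolding d_def
            using p drift[of x y] by (intro diff_right_mono mult_left_mono) (auto simp: xy E_def a_def)
          finally show ?thesis .
        qed
        ultimately show ?thesis by blast
      qed
    qed (use t in auto)
    thus ?thesis by (simp add: w_def)
  qed
  from one_sided[of A] one_sided[of "- A"] show ?thesis by (simp add: prob_in_compl)
qed

text \<open>Comparing \<open>z\<close> with its finitely many neighbours, the coupling bound controls the time derivative of
  \<open>P (X t \<in> A)\<close> for the process started in \<open>z\<close> by a constant times \<open>exp (- \<kappa> t)\<close>. Integrating, these
  probabilities converge exponentially fast and uniformly in the set \<open>A\<close>. Uniformity prevents mass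
  from escaping to infinity: at a late time some finite set carries almost all the mass, and it keeps
  almost all of it in the limit. So the limit is a probability distribution. It is invariant by the
  Chapman-Kolmogorov equation, and unique because every starting point has the same limit.\<close>

lemma exponential_ergodicity:
  fixes D :: "'s \<Rightarrow> 's \<Rightarrow> real"
  assumes fin: "\<And>x. finite {y. q x y \<noteq> 0}"
    and D_nonneg: "\<And>x y. 0 \<le> D x y"
    and D_ge_1: "\<And>x y. x \<noteq> y \<Longrightarrow> 1 \<le> D x y"
    and sublevel: "\<And>r. finite {(x, y). D x y \<le> r}"
    and drift: "\<And>x y. (x, y) \<noteq> (z, z) \<Longrightarrow>
        jump_generator q (\<lambda>x'. D x' y) x + jump_generator q (\<lambda>y'. D x y') y \<le> - \<kappa> * D x y"
    and \<kappa>: "0 < \<kappa>"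
  shows "\<exists>\<pi>. stationary_distribution P X \<pi> \<and>
           (\<forall>\<pi>'. stationary_distribution P X \<pi>' \<longrightarrow> \<pi>' = \<pi>) \<and>
           (\<exists>K1>0. \<exists>K2>0. \<forall>x. \<forall>t\<ge>0. \<bar>trans_prob P X t z x - \<pi> x\<bar> \<le> K1 * exp (- K2 * t))"
proof -
  have coupling: "\<bar>prob_in A t x - prob_in A t y\<bar> \<le> exp (- \<kappa> * t) * D x y" if "0 \<le> t" for A t x y
    by (rule prob_in_coupling_bound[OF fin D_nonneg _ sublevel _ \<kappa> that]) (fact D_ge_1 drift)+
  define C where "C = (\<Sum>y | q z y \<noteq> 0. \<bar>q z y\<bar> * D y z)"
  have "0 \<le> C" unfolding C_def using D_nonneg by (intro sum_nonneg) auto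
  have speed: "\<bar>jump_generator q (prob_in A t) z\<bar> \<le> C * exp (- \<kappa> * t)" if "0 \<le> t" for A t
  proof -
    have "\<bar>jump_generator q (prob_in A t) z\<bar> \<le> (\<Sum>y | q z y \<noteq> 0. \<bar>q z y * (prob_in A t y - prob_in A t z)\<bar>)"
      unfolding jump_generator_def by (rule sum_abs)
    also have "\<dots> \<le> (\<Sum>y | q z y \<noteq> 0. \<bar>q z y\<bar> * (exp (- \<kappa> * t) * D y z))"
      unfolding abs_mult using coupling[OF that] by (intro sum_mono mult_left_mono) auto
    also have "\<dots> = C * exp (- \<kappa> * t)"
      by (simp add: C_def sum_distrib_left sum_distrib_right mult_ac)
    finally show ?thesis .
  qed
  \<comment> \<open>The integral of the bound \<open>C exp (- \<kappa> t)\<close> on the speed over \<open>{s..}\<close> is \<open>K exp (- \<kappa> s)\<close>.\<close>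
  define K where "K = C / \<kappa>"
  have K: "0 \<le> K" "K * \<kappa> = C" using \<open>0 \<le> C\<close> \<kappa> by (auto simp: K_def)
  have cauchy: "\<bar>prob_in A t z - prob_in A s z\<bar> \<le> K * exp (- \<kappa> * s)" if st: "0 \<le> s" "s \<le> t" for A s t
  proof -
    have cont: "continuous_on {s..t} (\<lambda>r. prob_in A r z)"
      using st by (intro continuous_on_subset[OF continuous_on_prob_in]) auto
    have "prob_in A t z + K * exp (- \<kappa> * t) \<le> prob_in A s z + K * exp (- \<kappa> * s)"
    proof (rule DERIV_nonpos_imp_decreasing_open[OF st(2)])
      fix r assume r: "s < r" "r < t"
      have "((\<lambda>r. prob_in A r z + K * exp (- \<kappa> * r)) has_real_derivative
              jump_generator q (prob_in A r) z - (K * \<kappa>) * exp (- \<kappa> * r)) (at r)"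
        using st r by (auto intro!: derivative_eq_intros backward_equation fin)
      moreover have "jump_generator q (prob_in A r) z - (K * \<kappa>) * exp (- \<kappa> * r) \<le> 0"
        using speed[of r A] r st K by auto
      ultimately show "\<exists>d. ((\<lambda>r. prob_in A r z + K * exp (- \<kappa> * r)) has_real_derivative d) (at r) \<and> d \<le> 0"
        by blast
    qed (intro continuous_intros cont)
    moreover have "prob_in A s z - K * exp (- \<kappa> * s) \<le> prob_in A t z - K * exp (- \<kappa> * t)"
    proof (rule DERIV_nonneg_imp_increasing_open[OF st(2)])
      fix r assume r: "s < r" "r < t"
      have "((\<lambda>r. prob_in A r z - K * exp (- \<kappa> * r)) has_real_derivative
              jump_generator q (prob_in A r) z + (K * \<kappa>) * exp (- \<kappa> * r)) (at r)"
        using st r by (auto intro!: derivative_eq_intros backward_equation fin)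
      moreover have "0 \<le> jump_generator q (prob_in A r) z + (K * \<kappa>) * exp (- \<kappa> * r)"
        using speed[of r A] r st K by auto
      ultimately show "\<exists>d. ((\<lambda>r. prob_in A r z - K * exp (- \<kappa> * r)) has_real_derivative d) (at r) \<and> 0 \<le> d"
        by blast
    qed (intro continuous_intros cont)
    moreover have "0 \<le> K * exp (- \<kappa> * t)" using K by simp
    ultimately show ?thesis by linarith
  qed
  have decay: "((\<lambda>s. K * exp (- \<kappa> * s)) \<longlongrightarrow> 0) at_top"
    using \<kappa> by real_asymp
  have "\<exists>l. \<forall>s\<ge>0. \<bar>prob_in A s z - l\<bar> \<le> K * exp (- \<kappa> * s)" for A
  proof -
    have "Cauchy (\<lambda>n. prob_in A (real n) z)"
    proof (rule metric_CauchyI)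
      fix e :: real assume "0 < e"
      then obtain s0 where s0: "\<And>s. s0 \<le> s \<Longrightarrow> K * exp (- \<kappa> * s) < e"
        using order_tendstoD(2)[OF decay] by (auto simp: eventually_at_top_linorder)
      have "dist (prob_in A (real m) z) (prob_in A (real n) z) < e"
        if "m \<ge> nat \<lceil>s0\<rceil>" "n \<ge> nat \<lceil>s0\<rceil>" for m n
      proof -
        have "s0 \<le> real (min m n)" using that by linarith
        moreover have "\<bar>prob_in A (real m) z - prob_in A (real n) z\<bar> \<le> K * exp (- \<kappa> * real (min m n))"
          using cauchy[of "real m" "real n" A] cauchy[of "real n" "real m" A]
          by (cases "m \<le> n") (auto simp: min_def abs_minus_commute)
        ultimately show ?thesis using s0[of "real (min m n)"] by (simp add: dist_real_def)
      qed
      thus "\<exists>M. \<forall>m\<ge>M. \<forall>n\<ge>M. dist (prob_in A (real m) z) (prob_in A (real n) z) < e" by blast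
    qed
    then obtain l where l: "(\<lambda>n. prob_in A (real n) z) \<longlonglongrightarrow> l"
      using Cauchy_convergent convergent_def by blast
    have "\<bar>prob_in A s z - l\<bar> \<le> K * exp (- \<kappa> * s)" if s: "0 \<le> s" for s
    proof (rule tendsto_upperbound)
      show "(\<lambda>n. \<bar>prob_in A s z - prob_in A (real n) z\<bar>) \<longlonglongrightarrow> \<bar>prob_in A s z - l\<bar>" by (intro tendsto_intros l)
      show "\<forall>\<^sub>F n in sequentially. \<bar>prob_in A s z - prob_in A (real n) z\<bar> \<le> K * exp (- \<kappa> * s)"
        using eventually_ge_at_top[of "nat \<lceil>s\<rceil>"]
      proof eventually_elim
        case (elim n)
        hence "s \<le> real n" by linarith
        thus ?case using cauchy[of s "real n" A] s by (simp add: abs_minus_commute)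
      qed
    qed simp
    thus ?thesis by blast
  qed
  then obtain L where L: "\<And>A s. 0 \<le> s \<Longrightarrow> \<bar>prob_in A s z - L A\<bar> \<le> K * exp (- \<kappa> * s)" by metis
  have prob_in_lim: "((\<lambda>s. prob_in A s z) \<longlongrightarrow> L A) at_top" for A
    by (rule LIM_zero_cancel, rule Lim_null_comparison[OF _ decay])
       (use L in \<open>auto intro: eventually_mono[OF eventually_ge_at_top[of 0]]\<close>)
  define \<pi> where "\<pi> y = L {y}" for y
  have law_lim: "((\<lambda>s. pmf (law s z) y) \<longlongrightarrow> \<pi> y) at_top" for y
    using prob_in_lim[of "{y}"] by (simp add: prob_in_singleton \<pi>_def)
  have \<pi>_nonneg: "0 \<le> \<pi> y" for y
    by (rule tendsto_lowerbound[OF law_lim]) auto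
  have L_sum: "L A = (\<Sum>y\<in>A. \<pi> y)" if "finite A" for A
  proof (rule tendsto_unique[OF _ prob_in_lim])
    have "((\<lambda>s. \<Sum>y\<in>A. pmf (law s z) y) \<longlongrightarrow> (\<Sum>y\<in>A. \<pi> y)) at_top"
      by (intro tendsto_sum law_lim)
    thus "((\<lambda>s. prob_in A s z) \<longlongrightarrow> (\<Sum>y\<in>A. \<pi> y)) at_top"
      using that by (simp add: prob_in_def measure_measure_pmf_finite)
  qed simp
  have L_le_1: "L A \<le> 1" for A
    by (rule tendsto_upperbound[OF prob_in_lim]) (auto simp: prob_in_bounds)
  have \<pi>_sums: "(\<pi> has_sum 1) UNIV"
  proof -
    have sub: "\<pi> summable_on UNIV"
      by (rule nonneg_bdd_above_summable_on)
         (use \<pi>_nonneg L_le_1 in \<open>auto intro!: bdd_aboveI[of _ 1] simp: L_sum[symmetric]\<close>)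
    hence sum: "(\<pi> has_sum infsum \<pi> UNIV) UNIV" by simp
    have "infsum \<pi> UNIV \<le> 1"
      by (rule has_sum_le_finite_sums[OF sum]) (use L_le_1 in \<open>simp add: L_sum[symmetric]\<close>)
    moreover have "1 \<le> infsum \<pi> UNIV + e" if "e > 0" for e
    proof -
      have "\<forall>\<^sub>F s in at_top. K * exp (- \<kappa> * s) < e / 2 \<and> 0 \<le> s"
        using order_tendstoD(2)[OF decay, of "e/2"] that eventually_ge_at_top[of 0] by (auto intro: eventually_conj)
      then obtain s where s: "K * exp (- \<kappa> * s) < e / 2" "0 \<le> s"
        using eventually_happens' trivial_limit_at_top_linorder by blast
      have "(pmf (law s z) has_sum 1) UNIV"
        using has_sum_pmf_expectation[of "\<lambda>_. 1" 1 "law s z"] by simp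
      from has_sum_finite_approximation[OF this, of "e/2"] that
      obtain A where A: "finite A" "dist (sum (pmf (law s z)) A) 1 \<le> e / 2" by auto
      have "prob_in A s z = sum (pmf (law s z)) A" using A by (simp add: prob_in_def measure_measure_pmf_finite)
      hence "1 \<le> L A + e" using A(2) s L[OF s(2), of A] unfolding dist_real_def by linarith
      also have "L A \<le> infsum \<pi> UNIV"
        unfolding L_sum[OF A(1)] by (rule finite_sum_le_has_sum[OF sum A(1)]) (auto simp: \<pi>_nonneg)
      finally show ?thesis by simp
    qed
    hence "1 \<le> infsum \<pi> UNIV" by (rule field_le_epsilon)
    ultimately show ?thesis using sum by simp
  qed
  obtain M where M: "pmf M = \<pi>" using ex_pmf_of_has_sum[OF \<pi>_nonneg \<pi>_sums] by blast
  have invariant: "bind_pmf M (law t) = M" if t: "0 \<le> t" for t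
  proof (rule bind_pmf_eqI)
    fix A :: "'s set" and y assume A: "finite A"
    have "((\<lambda>s. pmf (law (s + t) z) y) \<longlongrightarrow> \<pi> y) at_top"
      by (rule filterlim_compose[OF law_lim]) real_asymp
    moreover have "((\<lambda>s. \<Sum>x\<in>A. pmf (law s z) x * pmf (law t x) y) \<longlongrightarrow> (\<Sum>x\<in>A. \<pi> x * pmf (law t x) y)) at_top"
      by (intro tendsto_intros law_lim)
    moreover have "\<forall>\<^sub>F s in at_top. (\<Sum>x\<in>A. pmf (law s z) x * pmf (law t x) y) \<le> pmf (law (s + t) z) y"
      using eventually_ge_at_top[of 0]
    proof eventually_elim
      case (elim s)
      have "((\<lambda>x. pmf (law s z) x * pmf (law t x) y) has_sum pmf (law (s + t) z) y) UNIV"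
        unfolding chapman_kolmogorov[OF elim t, symmetric] pmf_bind
        by (rule has_sum_pmf_expectation[of _ 1]) (simp add: pmf_le_1)
      thus ?case by (rule finite_sum_le_has_sum[OF _ A]) auto
    qed
    ultimately show "(\<Sum>x\<in>A. pmf M x * pmf (law t x) y) \<le> pmf M y"
      unfolding M by (intro tendsto_le[OF trivial_limit_at_top_linorder])
  qed
  have "stationary_distribution P X \<pi>"
    unfolding stationary_distribution_def
  proof (intro conjI allI impI)
    fix t :: real and y assume t: "0 \<le> t"
    have "((\<lambda>x. pmf M x * pmf (law t x) y) has_sum pmf (bind_pmf M (law t)) y) UNIV"
      unfolding pmf_bind by (rule has_sum_pmf_expectation[of _ 1]) (simp add: pmf_le_1)
    thus "((\<lambda>x. \<pi> x * trans_prob P X t x y) has_sum \<pi> y) UNIV"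
      by (simp add: invariant[OF t] M pmf_law[OF t])
  qed (auto simp: \<pi>_nonneg \<pi>_sums)
  moreover have "\<pi>' = \<pi>" if stat: "stationary_distribution P X \<pi>'" for \<pi>'
  proof
    fix y
    obtain N where N: "pmf N = \<pi>'"
      using stat ex_pmf_of_has_sum[of \<pi>'] by (auto simp: stationary_distribution_def)
    have lim: "(\<lambda>n. pmf (law (real n) x) y) \<longlonglongrightarrow> \<pi> y" for x
    proof -
      have "(\<lambda>n. pmf (law (real n) x) y - pmf (law (real n) z) y) \<longlonglongrightarrow> 0"
      proof (rule Lim_null_comparison)
        show "\<forall>\<^sub>F n in sequentially. norm (pmf (law (real n) x) y - pmf (law (real n) z) y)
                \<le> exp (- \<kappa> * real n) * D x z"
          using coupling[of _ "{y}" x z] by (simp add: prob_in_singleton)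
        show "(\<lambda>n. exp (- \<kappa> * real n) * D x z) \<longlonglongrightarrow> 0" using \<kappa> by real_asymp
      qed
      moreover have "(\<lambda>n. pmf (law (real n) z) y) \<longlonglongrightarrow> \<pi> y"
        by (rule filterlim_compose[OF law_lim filterlim_real_sequentially])
      ultimately show ?thesis using tendsto_add by fastforce
    qed
    have "(\<lambda>n. measure_pmf.expectation N (\<lambda>x. pmf (law (real n) x) y)) \<longlonglongrightarrow> measure_pmf.expectation N (\<lambda>_. \<pi> y)"
      by (rule integral_dominated_convergence[where w = "\<lambda>_. 1"]) (auto simp: lim pmf_le_1)
    moreover have "measure_pmf.expectation N (\<lambda>x. pmf (law (real n) x) y) = \<pi>' y" for n
    proof (rule has_sum_unique)
      show "((\<lambda>x. pmf N x * pmf (law (real n) x) y)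
         has_sum measure_pmf.expectation N (\<lambda>x. pmf (law (real n) x) y)) UNIV"
        by (rule has_sum_pmf_expectation[of _ 1]) (simp add: pmf_le_1)
      show "((\<lambda>x. pmf N x * pmf (law (real n) x) y) has_sum \<pi>' y) UNIV"
        using stat by (simp add: stationary_distribution_def N pmf_law)
    qed
    ultimately show "\<pi>' y = \<pi> y" by (simp add: LIMSEQ_const_iff)
  qed
  moreover have "\<bar>trans_prob P X t z x - \<pi> x\<bar> \<le> (K + 1) * exp (- \<kappa> * t)" if t: "0 \<le> t" for x t
    using L[OF t, of "{x}"] by (simp add: prob_in_singleton pmf_law[OF t] \<pi>_def distrib_right add_increasing2)
  moreover have "0 < K + 1" using K by simp
  ultimately show ?thesis using \<kappa> by blast
qed

end

section \<open>Exponential drift of a stable network\<close>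

definition population :: "nat ^ 'n \<Rightarrow> nat" where
  "population x = (\<Sum>i\<in>UNIV. x $ i)"

lemma population_add: "population (x + axis i 1) = Suc (population x)"
  by (simp add: population_def axis_def sum.distrib)

lemma population_diff:
  assumes "0 < x $ i"
  shows "population (x - axis i 1) = population x - 1"
proof -
  have "x - axis i 1 + axis i 1 = x"
    using assms by (auto simp: vec_eq_iff axis_def)
  thus ?thesis using population_add[of "x - axis i 1" i] by simp
qed

lemma population_0_iff: "population x = 0 \<longleftrightarrow> x = 0"
  by (auto simp: population_def vec_eq_iff)

lemma finite_population_le: "finite {x :: nat ^ 'n. population x \<le> k}"
proof (rule finite_subset)
  show "{x :: nat ^ 'n. population x \<le> k} \<subseteq> vec_lambda ` (UNIV \<rightarrow>\<^sub>E {..k})"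
  proof
    fix x :: "nat ^ 'n" assume "x \<in> {x. population x \<le> k}"
    moreover have "x $ i \<le> population x" for i
      unfolding population_def by (rule member_le_sum) auto
    ultimately have "vec_nth x \<in> UNIV \<rightarrow>\<^sub>E {..k}" by (auto intro: order_trans)
    thus "x \<in> vec_lambda ` (UNIV \<rightarrow>\<^sub>E {..k})" by (metis image_eqI vec_nth_inverse)
  qed
qed (intro finite_imageI finite_PiE; simp)

lemma exp_le_quadratic:
  fixes u :: real assumes "u \<le> 1/2"
  shows "exp u \<le> 1 + u + 2 * u\<^sup>2"
proof -
  have "1 - u \<le> exp (- u)" using exp_ge_add_one_self[of "- u"] by simp
  hence "(1 - u) * exp u \<le> exp (- u) * exp u" by (intro mult_right_mono) auto
  hence "(1 - u) * exp u \<le> 1" by (simp add: mult_exp_exp)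
  also have "1 \<le> 1 + u\<^sup>2 * (1 - 2 * u)" using assms by simp
  also have "\<dots> = (1 - u) * (1 + u + 2 * u\<^sup>2)" by (simp add: power2_eq_square algebra_simps)
  finally show ?thesis using assms by simp
qed

lemma generator_add:
  "generator lam \<phi> (\<lambda>x. f x + g x) x = generator lam \<phi> f x + generator lam \<phi> g x"
  unfolding generator_def sum.distrib[symmetric] by (simp add: algebra_simps)

lemma generator_cmult: "generator lam \<phi> (\<lambda>x. c * f x) x = c * generator lam \<phi> f x"
  unfolding generator_def sum_distrib_left by (simp add: algebra_simps)

lemma generator_const: "generator lam \<phi> (\<lambda>x. c) x = 0"
  by (simp add: generator_def)

text \<open>The properties of proportional fairness that make the network stable. Up to a factor \<open>2\<close> the mean
  drift of the square of \<open>F\<close> in state \<open>x\<close> is the population minus the sum of \<open>x i \<phi> i / \<lambda> i\<close>, plus bounded terms. So the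
  last assumption says that this square decreases at a rate proportional to the population
  once that is large.\<close>

locale stable_network =
  fixes lam :: "real ^ 'n" and \<phi> :: "nat ^ 'n \<Rightarrow> real ^ 'n" and \<epsilon> B :: real
  assumes lam_pos: "0 < lam $ i"
    and \<phi>_nonneg: "0 \<le> \<phi> x $ i"
    and \<phi>_le: "\<phi> x $ i \<le> B"
    and \<phi>_empty: "x $ i = 0 \<Longrightarrow> \<phi> x $ i = 0"
    and \<epsilon>_pos: "0 < \<epsilon>"
    and stability: "(1 + \<epsilon>) * real (population x) \<le> (\<Sum>i\<in>UNIV. real (x $ i) * \<phi> x $ i / lam $ i)"
begin

abbreviation "total_arrival \<equiv> \<Sum>i\<in>UNIV. lam $ i"

lemma total_arrival_pos: "0 < total_arrival"
  by (rule sum_pos) (auto simp: lam_pos)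

lemma lam_le_total: "lam $ i \<le> total_arrival"
  by (rule member_le_sum) (auto simp: lam_pos less_imp_le)

lemma F_sq: "(F_fun lam x)\<^sup>2 = (\<Sum>i\<in>UNIV. (real (x $ i))\<^sup>2 / lam $ i)"
  unfolding F_fun_def by (rule real_sqrt_pow2) (auto intro!: sum_nonneg simp: lam_pos less_imp_le)

lemma F_nonneg: "0 \<le> F_fun lam x"
  unfolding F_fun_def by (intro real_sqrt_ge_zero sum_nonneg) (auto simp: lam_pos less_imp_le)

lemma F_sq_add: "(F_fun lam (x + axis i 1))\<^sup>2 = (F_fun lam x)\<^sup>2 + (2 * real (x $ i) + 1) / lam $ i"
proof -
  have "(real ((x + axis i 1) $ j))\<^sup>2 / lam $ j
      = (real (x $ j))\<^sup>2 / lam $ j + (if j = i then (2 * real (x $ i) + 1) / lam $ i else 0)" for j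
    by (auto simp: axis_def power2_eq_square add_divide_distrib[symmetric] algebra_simps)
  thus ?thesis by (simp add: F_sq sum.distrib)
qed

lemma F_sq_diff:
  assumes "0 < x $ i"
  shows "(F_fun lam (x - axis i 1))\<^sup>2 = (F_fun lam x)\<^sup>2 + (1 - 2 * real (x $ i)) / lam $ i"
proof -
  have "x - axis i 1 + axis i 1 = x" "(x - axis i 1) $ i = x $ i - 1"
    using assms by (auto simp: vec_eq_iff axis_def)
  thus ?thesis using F_sq_add[of "x - axis i 1" i] assms
    by (simp add: add_divide_distrib diff_divide_distrib del: One_nat_def)
qed

lemma component_le_F: "real (x $ i) * sqrt (1 / lam $ i) \<le> F_fun lam x"
proof (rule power2_le_imp_le[OF _ F_nonneg])
  have "(real (x $ i))\<^sup>2 / lam $ i \<le> (\<Sum>i\<in>UNIV. (real (x $ i))\<^sup>2 / lam $ i)"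
    by (rule member_le_sum) (auto simp: lam_pos less_imp_le)
  thus "(real (x $ i) * sqrt (1 / lam $ i))\<^sup>2 \<le> (F_fun lam x)\<^sup>2"
    using lam_pos[of i] by (simp add: F_sq power_mult_distrib)
qed

text \<open>The function \<open>F\<close> is a Euclidean norm and a jump has length \<open>1 / sqrt (\<lambda> i)\<close> in it. The proof squares
  both sides of the triangle inequality.\<close>

lemma F_step_bounded:
  assumes "y = x + axis i 1 \<or> y = x - axis i 1 \<and> 0 < x $ i"
  shows "\<bar>F_fun lam y - F_fun lam x\<bar> \<le> sqrt (1 / lam $ i)"
proof -
  define r where "r = sqrt (1 / lam $ i)"
  have r: "0 < r" "r\<^sup>2 = 1 / lam $ i" using lam_pos[of i] by (auto simp: r_def)
  have xr: "real (x $ i) * r \<le> F_fun lam x" using component_le_F by (simp add: r_def)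
  have xrr: "2 * real (x $ i) * r\<^sup>2 \<le> 2 * F_fun lam x * r"
    using mult_right_mono[OF xr, of "2 * r"] r(1) by (simp add: power2_eq_square algebra_simps)
  have nonneg: "0 \<le> 2 * F_fun lam x * r" "0 \<le> 2 * real (x $ i) * r\<^sup>2"
    using F_nonneg[of x] r(1) by auto
  have "(F_fun lam y)\<^sup>2 = (F_fun lam x)\<^sup>2 + (2 * real (x $ i) * r\<^sup>2 + r\<^sup>2) \<or>
        (F_fun lam y)\<^sup>2 = (F_fun lam x)\<^sup>2 + (r\<^sup>2 - 2 * real (x $ i) * r\<^sup>2)"
    using assms
  proof
    assume "y = x + axis i 1"
    thus ?thesis using F_sq_add[of x i] unfolding r(2) by (simp add: add_divide_distrib)
  next
    assume "y = x - axis i 1 \<and> 0 < x $ i"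
    thus ?thesis using F_sq_diff[of x i] unfolding r(2) by (simp add: diff_divide_distrib)
  qed
  hence upper: "(F_fun lam y)\<^sup>2 \<le> (F_fun lam x + r)\<^sup>2"
    and lower: "(F_fun lam x - r)\<^sup>2 \<le> (F_fun lam y)\<^sup>2"
    unfolding power2_sum power2_diff using xrr nonneg by (elim disjE; linarith)+
  have "F_fun lam y \<le> F_fun lam x + r" using power2_le_imp_le[OF upper] r(1) F_nonneg[of x] by linarith
  moreover have "F_fun lam x - r \<le> F_fun lam y" by (rule power2_le_imp_le[OF lower F_nonneg])
  ultimately show ?thesis by (simp add: r_def abs_le_iff)
qed

text \<open>The square root lies below its tangent. This is how the drift of the square of \<open>F\<close> is passed on to
  \<open>F\<close> itself.\<close>

lemma sqrt_tangent:
  fixes s f :: real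
  assumes "0 < f"
  shows "s - f \<le> (s\<^sup>2 - f\<^sup>2) / (2 * f)"
proof -
  have "0 \<le> (s - f)\<^sup>2" by simp
  thus ?thesis using assms by (simp add: field_simps power2_eq_square)
qed

lemma population_le_F: "real (population x) \<le> total_arrival * (F_fun lam x)\<^sup>2"
proof -
  have "real (population x) = (\<Sum>i\<in>UNIV. real (x $ i))" by (simp add: population_def)
  also have "\<dots> \<le> (\<Sum>i\<in>UNIV. total_arrival * ((real (x $ i))\<^sup>2 / lam $ i))"
  proof (rule sum_mono)
    fix i
    have "real (x $ i) \<le> (real (x $ i))\<^sup>2" by (cases "x $ i") (auto simp: power2_eq_square)
    also have "\<dots> = lam $ i * ((real (x $ i))\<^sup>2 / lam $ i)" using lam_pos[of i] by simp
    also have "\<dots> \<le> total_arrival * ((real (x $ i))\<^sup>2 / lam $ i)"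
      using lam_pos[of i] by (intro mult_right_mono lam_le_total) auto
    finally show "real (x $ i) \<le> total_arrival * ((real (x $ i))\<^sup>2 / lam $ i)" .
  qed
  finally show ?thesis by (simp add: F_sq sum_distrib_left)
qed

definition step_bound :: real where
  "step_bound = (\<Sum>i\<in>UNIV. sqrt (1 / lam $ i))"

lemma step_bound_pos: "0 < step_bound"
  unfolding step_bound_def by (rule sum_pos) (auto simp: lam_pos)

lemma sqrt_le_step_bound: "sqrt (1 / lam $ i) \<le> step_bound"
  unfolding step_bound_def by (rule member_le_sum) (auto simp: lam_pos less_imp_le)

lemma F_le_population: "F_fun lam x \<le> step_bound * real (population x)"
proof -
  have "F_fun lam x = L2_set (\<lambda>i. real (x $ i) * sqrt (1 / lam $ i)) UNIV"
    unfolding F_fun_def L2_set_def using lam_pos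
    by (intro arg_cong[of _ _ sqrt] sum.cong) (auto simp: power_mult_distrib less_imp_le)
  also have "\<dots> \<le> (\<Sum>i\<in>UNIV. real (x $ i) * sqrt (1 / lam $ i))"
    by (rule L2_set_le_sum) (auto simp: lam_pos less_imp_le)
  also have "\<dots> \<le> (\<Sum>i\<in>UNIV. real (x $ i) * step_bound)"
    by (intro sum_mono mult_left_mono sqrt_le_step_bound) auto
  also have "\<dots> = step_bound * real (population x)"
    by (simp only: population_def of_nat_sum sum_distrib_right mult.commute[of step_bound])
  finally show ?thesis .
qed

text \<open>Expanding the exponential to second order: the first order term carries the drift of \<open>F\<close>, which
  is about \<open>- \<epsilon>\<close> times population over \<open>F\<close>, and the quadratic remainder is uniformly bounded because
  the jumps of \<open>F\<close> are.\<close>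

lemma generator_G_bound:
  assumes x: "0 < population x" and \<delta>: "0 < \<delta>" "\<delta> * step_bound \<le> 1 / 2"
  shows "generator lam \<phi> (G_fun lam \<delta>) x \<le> G_fun lam \<delta> x *
     (\<delta> * (- \<epsilon> * real (population x) + (\<Sum>i\<in>UNIV. (lam $ i + B) / (2 * lam $ i))) / F_fun lam x
       + \<delta>\<^sup>2 * (2 * step_bound\<^sup>2 * (\<Sum>i\<in>UNIV. lam $ i + B)))"
proof -
  define f where "f = F_fun lam x"
  have f: "0 < f"
  proof -
    have "0 < total_arrival * f\<^sup>2" using population_le_F[of x] x by (simp add: f_def)
    thus ?thesis using F_nonneg[of x] by (auto simp: f_def less_le)
  qed
  have step: "G_fun lam \<delta> y - G_fun lam \<delta> x
       \<le> G_fun lam \<delta> x * (\<delta> * (((F_fun lam y)\<^sup>2 - f\<^sup>2) / (2 * f)) + 2 * \<delta>\<^sup>2 * step_bound\<^sup>2)"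
    if y: "y = x + axis i 1 \<or> y = x - axis i 1 \<and> 0 < x $ i" for y i
  proof -
    define u where "u = \<delta> * (F_fun lam y - f)"
    have abs: "\<bar>F_fun lam y - f\<bar> \<le> step_bound"
      using F_step_bounded[OF y] sqrt_le_step_bound[of i] by (simp add: f_def)
    have "u \<le> \<delta> * step_bound" unfolding u_def using abs \<delta> by (intro mult_left_mono) auto
    hence "u \<le> 1 / 2" using \<delta> by simp
    have "u \<le> \<delta> * (((F_fun lam y)\<^sup>2 - f\<^sup>2) / (2 * f))"
      unfolding u_def using sqrt_tangent[OF f] \<delta> by (intro mult_left_mono) auto
    moreover have "(F_fun lam y - f)\<^sup>2 \<le> step_bound\<^sup>2"
      using abs step_bound_pos by (simp add: abs_le_square_iff[symmetric])
    hence "2 * u\<^sup>2 \<le> 2 * \<delta>\<^sup>2 * step_bound\<^sup>2"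
      unfolding u_def power_mult_distrib by (simp add: mult_left_mono)
    ultimately have "exp u - 1 \<le> \<delta> * (((F_fun lam y)\<^sup>2 - f\<^sup>2) / (2 * f)) + 2 * \<delta>\<^sup>2 * step_bound\<^sup>2"
      using exp_le_quadratic[OF \<open>u \<le> 1/2\<close>] by simp
    hence "G_fun lam \<delta> x * (exp u - 1)
       \<le> G_fun lam \<delta> x * (\<delta> * (((F_fun lam y)\<^sup>2 - f\<^sup>2) / (2 * f)) + 2 * \<delta>\<^sup>2 * step_bound\<^sup>2)"
      by (intro mult_left_mono) (auto simp: G_fun_def)
    moreover have "G_fun lam \<delta> y = G_fun lam \<delta> x * exp u"
      by (simp add: G_fun_def u_def f_def mult_exp_exp algebra_simps)
    ultimately show ?thesis by (simp add: algebra_simps)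
  qed
  have summand: "lam $ i * (G_fun lam \<delta> (x + axis i 1) - G_fun lam \<delta> x)
        + \<phi> x $ i * (G_fun lam \<delta> (x - axis i 1) - G_fun lam \<delta> x)
      \<le> G_fun lam \<delta> x * (\<delta> / f * (real (x $ i) - real (x $ i) * \<phi> x $ i / lam $ i + (lam $ i + B) / (2 * lam $ i))
            + \<delta>\<^sup>2 * (2 * step_bound\<^sup>2 * (lam $ i + B)))" (is "?L \<le> _ * ?R") for i
  proof -
    let ?up = "\<delta> * ((2 * real (x $ i) + 1) / lam $ i / (2 * f)) + 2 * \<delta>\<^sup>2 * step_bound\<^sup>2"
    let ?down = "\<delta> * ((1 - 2 * real (x $ i)) / lam $ i / (2 * f)) + 2 * \<delta>\<^sup>2 * step_bound\<^sup>2"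
    have "lam $ i * (G_fun lam \<delta> (x + axis i 1) - G_fun lam \<delta> x) \<le> lam $ i * (G_fun lam \<delta> x * ?up)"
      using step[of "x + axis i 1" i] lam_pos[of i] by (intro mult_left_mono) (auto simp: F_sq_add f_def simp del: One_nat_def)
    moreover have "\<phi> x $ i * (G_fun lam \<delta> (x - axis i 1) - G_fun lam \<delta> x) \<le> \<phi> x $ i * (G_fun lam \<delta> x * ?down)"
    proof (cases "x $ i = 0")
      case False
      thus ?thesis using step[of "x - axis i 1" i] \<phi>_nonneg[of x i]
        by (intro mult_left_mono) (auto simp: F_sq_diff f_def simp del: One_nat_def)
    qed (simp add: \<phi>_empty)
    ultimately have "?L \<le> G_fun lam \<delta> x * (lam $ i * ?up + \<phi> x $ i * ?down)"
      by (simp add: algebra_simps)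
    also have "lam $ i * ?up + \<phi> x $ i * ?down
      = \<delta> / f * (real (x $ i) - real (x $ i) * \<phi> x $ i / lam $ i + (lam $ i + \<phi> x $ i) / (2 * lam $ i))
            + \<delta>\<^sup>2 * (2 * step_bound\<^sup>2 * (lam $ i + \<phi> x $ i))"
      using lam_pos[of i] f by (simp add: field_simps)
    also have "\<dots> \<le> ?R"
      using \<phi>_le[of x i] lam_pos[of i] \<delta> f
      by (intro add_mono mult_left_mono divide_right_mono) auto
    finally show ?thesis by (simp add: mult_left_mono G_fun_def)
  qed
  have "generator lam \<phi> (G_fun lam \<delta>) x
     \<le> (\<Sum>i\<in>UNIV. G_fun lam \<delta> x * (\<delta> / f * (real (x $ i) - real (x $ i) * \<phi> x $ i / lam $ i + (lam $ i + B) / (2 * lam $ i))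
            + \<delta>\<^sup>2 * (2 * step_bound\<^sup>2 * (lam $ i + B))))"
    unfolding generator_def by (intro sum_mono summand)
  also have "\<dots> = G_fun lam \<delta> x * (\<delta> / f * (real (population x) - (\<Sum>i\<in>UNIV. real (x $ i) * \<phi> x $ i / lam $ i)
            + (\<Sum>i\<in>UNIV. (lam $ i + B) / (2 * lam $ i)))
            + \<delta>\<^sup>2 * (2 * step_bound\<^sup>2 * (\<Sum>i\<in>UNIV. lam $ i + B)))"
    by (simp only: sum_distrib_left[symmetric] sum.distrib sum_subtractf population_def of_nat_sum)
  also have "\<dots> \<le> G_fun lam \<delta> x * (\<delta> / f * (- \<epsilon> * real (population x) + (\<Sum>i\<in>UNIV. (lam $ i + B) / (2 * lam $ i)))
            + \<delta>\<^sup>2 * (2 * step_bound\<^sup>2 * (\<Sum>i\<in>UNIV. lam $ i + B)))"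
    using stability[of x] \<delta> f
    by (intro mult_left_mono add_right_mono) (auto simp: G_fun_def algebra_simps)
  finally show ?thesis by (simp add: f_def)
qed

text \<open>\<open>F\<close> is at most a multiple of the population and becomes large with it, so the first order drift
  stays below a negative constant times \<open>\<delta>\<close> far from the origin. A small \<open>\<delta>\<close> makes the remainder of order \<open>\<delta>\<close> squared negligible.\<close>

lemma exponential_drift:
  "\<exists>\<delta>>0. \<exists>\<gamma>>0. \<exists>K. \<forall>x. real (population x) > K \<longrightarrow>
      generator lam \<phi> (G_fun lam \<delta>) x \<le> - \<gamma> * G_fun lam \<delta> x"
proof -
  have B: "0 \<le> B" using \<phi>_nonneg \<phi>_le order_trans by blast
  define M where "M = step_bound"
  define B1 where "B1 = (\<Sum>i\<in>UNIV. (lam $ i + B) / (2 * lam $ i))"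
  define B2 where "B2 = 2 * M\<^sup>2 * (\<Sum>i\<in>UNIV. lam $ i + B)"
  have M: "0 < M" by (simp add: M_def step_bound_pos)
  have B1: "0 \<le> B1" unfolding B1_def using B lam_pos by (intro sum_nonneg) (auto simp: less_imp_le)
  have "0 < (\<Sum>i\<in>UNIV. lam $ i + B)" using B lam_pos by (intro sum_pos) (auto simp: add_pos_nonneg)
  hence B2: "0 < B2" unfolding B2_def using M by simp
  \<comment> \<open>The first bound permits the second order expansion, the second lets the remainder use up
    at most a quarter of the drift \<open>\<epsilon> / M\<close>.\<close>
  define \<delta> where "\<delta> = min (1 / (2 * M)) (\<epsilon> / (4 * M * B2))"
  define \<gamma> where "\<gamma> = \<delta> * (\<epsilon> / (4 * M))"
  have \<delta>: "0 < \<delta>" using M B2 \<epsilon>_pos by (simp add: \<delta>_def)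
  have "\<delta> \<le> 1 / (2 * M)" by (simp add: \<delta>_def)
  hence \<delta>M: "\<delta> * M \<le> 1 / 2" using M by (simp add: field_simps)
  have "\<delta> \<le> \<epsilon> / (4 * M * B2)" by (simp add: \<delta>_def)
  hence \<delta>B2: "\<delta> * B2 \<le> \<epsilon> / (4 * M)" using M B2 by (simp add: field_simps)
  \<comment> \<open>Where \<open>F\<close> exceeds this radius, the constant \<open>B1\<close> uses up at most half of the drift.\<close>
  define R where "R = 2 * M * B1 / \<epsilon>"
  have R: "0 \<le> R" using M B1 \<epsilon>_pos by (simp add: R_def)
  have "generator lam \<phi> (G_fun lam \<delta>) x \<le> - \<gamma> * G_fun lam \<delta> x"
    if large: "real (population x) > total_arrival * R\<^sup>2" for x
  proof -
    define f where "f = F_fun lam x"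
    define n where "n = real (population x)"
    have "0 \<le> total_arrival * R\<^sup>2" using total_arrival_pos by simp
    hence n: "0 < n" using large unfolding n_def by linarith
    have "total_arrival * R\<^sup>2 < total_arrival * f\<^sup>2" using large population_le_F[of x] by (simp add: f_def)
    hence "R\<^sup>2 < f\<^sup>2" using total_arrival_pos by (simp add: mult_less_cancel_left_pos)
    hence fR: "R < f" using power2_less_imp_less[of R f] F_nonneg[of x] by (simp add: f_def)
    hence f: "0 < f" using R by simp
    have "f \<le> M * n" using F_le_population[of x] by (simp add: f_def M_def n_def)
    hence "\<epsilon> / M \<le> \<epsilon> * n / f" using f M \<epsilon>_pos by (simp add: field_simps)
    moreover have "B1 / f \<le> \<epsilon> / (2 * M)" using fR f M \<epsilon>_pos by (simp add: R_def field_simps)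
    moreover have "- \<epsilon> / (2 * M) = \<epsilon> / (2 * M) - \<epsilon> / M" using M by (simp add: field_simps)
    ultimately have "- \<epsilon> * n / f + B1 / f \<le> - \<epsilon> / (2 * M)" by simp
    hence "(- \<epsilon> * n + B1) / f \<le> - \<epsilon> / (2 * M)"
      by (simp only: add_divide_distrib)
    hence "\<delta> * ((- \<epsilon> * n + B1) / f) \<le> \<delta> * (- \<epsilon> / (2 * M))"
      using \<delta> by (intro mult_left_mono) auto
    moreover have "\<delta> * (\<delta> * B2) \<le> \<delta> * (\<epsilon> / (4 * M))" using \<delta>B2 \<delta> by (intro mult_left_mono) auto
    moreover have "\<delta> * (- \<epsilon> / (2 * M)) + \<delta> * (\<epsilon> / (4 * M)) = - \<gamma>" using M by (simp add: \<gamma>_def field_simps)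
    moreover have "\<delta> * (- \<epsilon> * n + B1) / f + \<delta>\<^sup>2 * B2 = \<delta> * ((- \<epsilon> * n + B1) / f) + \<delta> * (\<delta> * B2)"
      by (simp only: power2_eq_square times_divide_eq_right mult.assoc)
    ultimately have bracket: "\<delta> * (- \<epsilon> * n + B1) / f + \<delta>\<^sup>2 * B2 \<le> - \<gamma>" by linarith
    have "generator lam \<phi> (G_fun lam \<delta>) x \<le> G_fun lam \<delta> x * (\<delta> * (- \<epsilon> * n + B1) / f + \<delta>\<^sup>2 * B2)"
      using generator_G_bound[of x \<delta>] n \<delta> \<delta>M unfolding B1_def B2_def M_def f_def n_def by simp
    also have "\<dots> \<le> G_fun lam \<delta> x * (- \<gamma>)"
      by (rule mult_left_mono[OF bracket]) (simp add: G_fun_def)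
    finally show ?thesis by (simp add: mult.commute)
  qed
  moreover have "0 < \<gamma>" using \<delta> M \<epsilon>_pos by (simp add: \<gamma>_def)
  ultimately show ?thesis using \<delta> by blast
qed

end

section \<open>Lyapunov function for two independent copies of the network\<close>

text \<open>The moves are indexed by queues here and by target states there. Truncated subtraction makes the
  state its own target at an empty queue, which costs nothing as that queue receives no service.\<close>

lemma jump_generator_network_rate:
  assumes "\<And>i. x $ i = 0 \<Longrightarrow> \<phi> x $ i = 0"
  shows "finite {y. network_rate lam \<phi> x y \<noteq> 0}"
    and "jump_generator (network_rate lam \<phi>) f x = generator lam \<phi> f x"
proof -
  define T where "T = range (\<lambda>i. x + axis i 1) \<union> range (\<lambda>i. x - axis i 1)"
  have T: "finite T" "\<And>i. x + axis i 1 \<in> T" "\<And>i. x - axis i 1 \<in> T" by (auto simp: T_def)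
  have sub: "{y. network_rate lam \<phi> x y \<noteq> 0} \<subseteq> T"
  proof (rule subsetI, rule ccontr)
    fix y assume y: "y \<in> {y. network_rate lam \<phi> x y \<noteq> 0}" "y \<notin> T"
    hence "y \<noteq> x + axis i 1" "y \<noteq> x - axis i 1" for i using T by metis+
    hence "network_rate lam \<phi> x y = 0" unfolding network_rate_def by (intro sum.neutral) auto
    thus False using y by simp
  qed
  show "finite {y. network_rate lam \<phi> x y \<noteq> 0}" by (rule finite_subset[OF sub T(1)])
  have "jump_generator (network_rate lam \<phi>) f x = (\<Sum>y\<in>T. network_rate lam \<phi> x y * (f y - f x))"
    unfolding jump_generator_def by (rule sum.mono_neutral_left[OF T(1) sub]) auto
  also have "\<dots> = (\<Sum>y\<in>T. \<Sum>i\<in>UNIV. (if y = x + axis i 1 then lam $ i * (f y - f x) else 0)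
       + (if y = x - axis i 1 then (if 0 < x $ i then \<phi> x $ i else 0) * (f y - f x) else 0))"
    unfolding network_rate_def sum_distrib_right by (intro sum.cong refl) (auto simp: distrib_right)
  also have "\<dots> = (\<Sum>i\<in>UNIV. \<Sum>y\<in>T. (if y = x + axis i 1 then lam $ i * (f y - f x) else 0)
       + (if y = x - axis i 1 then (if 0 < x $ i then \<phi> x $ i else 0) * (f y - f x) else 0))"
    by (rule sum.swap)
  also have "\<dots> = generator lam \<phi> f x"
    unfolding generator_def
  proof (rule sum.cong[OF refl])
    fix i
    show "(\<Sum>y\<in>T. (if y = x + axis i 1 then lam $ i * (f y - f x) else 0)
       + (if y = x - axis i 1 then (if 0 < x $ i then \<phi> x $ i else 0) * (f y - f x) else 0))
      = lam $ i * (f (x + axis i 1) - f x) + \<phi> x $ i * (f (x - axis i 1) - f x)"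
      using T assms[of i] by (simp add: sum.distrib del: One_nat_def)
  qed
  finally show "jump_generator (network_rate lam \<phi>) f x = generator lam \<phi> f x" .
qed

context stable_network
begin

abbreviation "total_service x \<equiv> \<Sum>i\<in>UNIV. \<phi> x $ i"

lemma total_service_nonneg: "0 \<le> total_service x"
  by (intro sum_nonneg \<phi>_nonneg)

lemma generator_population:
  "generator lam \<phi> (\<lambda>x. g (population x)) x
     = total_arrival * (g (Suc (population x)) - g (population x))
       + total_service x * (g (population x - 1) - g (population x))"
proof -
  have down: "\<phi> x $ i * (g (population (x - axis i 1)) - g (population x))
      = \<phi> x $ i * (g (population x - 1) - g (population x))" for i
    by (cases "x $ i = 0") (simp_all add: \<phi>_empty population_diff del: One_nat_def)
  thus ?thesis
    unfolding generator_def sum.distrib sum_distrib_right population_add down by simp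
qed

lemma total_service_bounded_below: "\<exists>m>0. \<forall>x. x \<noteq> 0 \<longrightarrow> m \<le> total_service x"
proof (intro exI conjI allI impI)
  define m where "m = Min (range (\<lambda>i. lam $ i))"
  have m_le: "m \<le> lam $ i" for i by (simp add: m_def)
  show m: "0 < m" unfolding m_def by (subst Min_gr_iff) (auto simp: lam_pos)
  fix x :: "nat ^ 'n" assume "x \<noteq> 0"
  hence pop: "0 < real (population x)" by (simp add: population_0_iff flip: neq0_conv)
  define s where "s = total_service x"
  have "real (population x) \<le> (1 + \<epsilon>) * real (population x)" using \<epsilon>_pos by (simp add: distrib_right)
  also have "\<dots> \<le> (\<Sum>i\<in>UNIV. real (x $ i) * \<phi> x $ i / lam $ i)" by (rule stability)
  also have "\<dots> \<le> (\<Sum>i\<in>UNIV. real (x $ i) * s / m)"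
  proof (intro sum_mono frac_le mult_left_mono mult_nonneg_nonneg m m_le)
    show "\<phi> x $ i \<le> s" for i unfolding s_def by (rule member_le_sum) (auto simp: \<phi>_nonneg)
  qed (auto simp: s_def \<phi>_nonneg total_service_nonneg)
  also have "\<dots> = real (population x) * (s / m)"
    by (simp add: population_def sum_distrib_right sum_divide_distrib)
  finally have "m \<le> s" using pop m by (simp add: field_simps)
  thus "m \<le> total_service x" by (simp add: s_def)
qed

lemma finite_G_sublevel:
  assumes "0 < \<delta>"
  shows "finite {x. G_fun lam \<delta> x \<le> r}"
proof (rule finite_subset[OF _ finite_population_le])
  show "{x. G_fun lam \<delta> x \<le> r} \<subseteq> {x. population x \<le> nat \<lceil>total_arrival * (r / \<delta>)\<^sup>2\<rceil>}"
  proof safe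
    fix x assume "G_fun lam \<delta> x \<le> r"
    hence "\<delta> * F_fun lam x \<le> r"
      using exp_ge_add_one_self[of "\<delta> * F_fun lam x"] unfolding G_fun_def by linarith
    hence "F_fun lam x \<le> r / \<delta>" using assms by (simp add: field_simps)
    hence "(F_fun lam x)\<^sup>2 \<le> (r / \<delta>)\<^sup>2" by (intro power_mono F_nonneg)
    hence "total_arrival * (F_fun lam x)\<^sup>2 \<le> total_arrival * (r / \<delta>)\<^sup>2"
      by (rule mult_left_mono) (simp add: total_arrival_pos less_imp_le)
    hence "real (population x) \<le> total_arrival * (r / \<delta>)\<^sup>2" using population_le_F order_trans by blast
    thus "population x \<le> nat \<lceil>total_arrival * (r / \<delta>)\<^sup>2\<rceil>" by linarith
  qed
qed

text \<open>The sum \<open>V\<close> of the two copies of \<open>G\<close> drifts downward except on a finite set of pairs. To make up for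
  these, a multiple of \<open>1 - \<theta> ^ n\<close> is added, with \<open>n\<close> the total population of the pair. Its increments decay
  so fast that one departure outweighs all arrivals, so its mean decreases at every pair other
  than the empty one. It is bounded and therefore does not change the order of magnitude of \<open>V\<close>. In
  this way the empty state alone takes the place of the finite set.\<close>

lemma pair_lyapunov_function:
  "\<exists>(D :: nat ^ 'n \<Rightarrow> nat ^ 'n \<Rightarrow> real) \<kappa>. 0 < \<kappa> \<and> (\<forall>x y. 1 \<le> D x y) \<and> (\<forall>r. finite {(x, y). D x y \<le> r}) \<and>
     (\<forall>x y. (x, y) \<noteq> (0, 0) \<longrightarrow>
        generator lam \<phi> (\<lambda>x'. D x' y) x + generator lam \<phi> (\<lambda>y'. D x y') y \<le> - \<kappa> * D x y)"
proof -
  obtain \<delta> \<gamma> K where \<delta>: "0 < \<delta>" and \<gamma>: "0 < \<gamma>" and outside: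
    "\<And>x. real (population x) > K \<Longrightarrow> generator lam \<phi> (G_fun lam \<delta>) x \<le> - \<gamma> * G_fun lam \<delta> x"
    using exponential_drift by blast
  let ?G = "G_fun lam \<delta>" and ?Q = "generator lam \<phi>"
  have G1: "1 \<le> ?G x" for x using \<delta> F_nonneg[of x] by (simp add: G_fun_def)
  obtain m where m: "0 < m" "\<And>x. x \<noteq> 0 \<Longrightarrow> m \<le> total_service x"
    using total_service_bounded_below by blast
  define S where "S = {x :: nat ^ 'n. population x \<le> nat \<lfloor>K\<rfloor>}"
  define b where "b = (\<Sum>x\<in>S. \<bar>?Q ?G x + \<gamma> * ?G x\<bar>)"
  have S: "finite S" unfolding S_def by (rule finite_population_le)
  have b: "0 \<le> b" unfolding b_def by (intro sum_nonneg) auto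
  have drift_G: "?Q ?G x \<le> - \<gamma> * ?G x + b" for x
  proof (cases "x \<in> S")
    case True
    have "\<bar>?Q ?G x + \<gamma> * ?G x\<bar> \<le> b" unfolding b_def by (rule member_le_sum[OF True]) (use S in auto)
    thus ?thesis by linarith
  next
    case False
    hence "real (population x) > K" by (simp add: S_def) linarith
    thus ?thesis using outside[of x] b by simp
  qed
  \<comment> \<open>A lost increment \<open>\<theta> ^ (n - 1)\<close> at departure rate \<open>m\<close> must beat a gain \<open>\<theta> ^ n\<close> at twice the
    total arrival rate.\<close>
  define \<theta> where "\<theta> = min (1 / 2) (m / (4 * total_arrival))"
  have \<theta>: "0 < \<theta>" "\<theta> \<le> 1 / 2" using m(1) total_arrival_pos by (auto simp: \<theta>_def)
  have "\<theta> \<le> m / (4 * total_arrival)" by (simp add: \<theta>_def)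
  hence \<theta>m: "4 * total_arrival * \<theta> \<le> m" using total_arrival_pos by (simp add: field_simps)
  define small where "small = {x. ?G x \<le> 4 * b / \<gamma>}"
  have small: "finite small" unfolding small_def using \<delta> by (rule finite_G_sublevel)
  \<comment> \<open>Pairs with \<open>V < 4 b / \<gamma>\<close> have total population at most \<open>N\<close>, so the decrease of the correction
    is at least \<open>m \<theta> ^ N / 4\<close> there; \<open>A\<close> scales this up to \<open>2 b\<close>.\<close>
  define N where "N = 2 * (\<Sum>x\<in>small. population x)"
  define A where "A = 8 * b / (m * \<theta> ^ N)"
  have A: "0 \<le> A" unfolding A_def using b m(1) \<theta> by simp
  define D where "D x y = ?G x + ?G y + A * (1 - \<theta> ^ (population x + population y))" for x y
  have correction: "0 \<le> 1 - \<theta> ^ n" "1 - \<theta> ^ n \<le> 1" for n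
    using \<theta> by (auto intro!: power_le_one)
  have D_ge: "?G x + ?G y \<le> D x y" for x y
    unfolding D_def using mult_nonneg_nonneg[OF A correction(1)] by simp
  have D_le: "D x y \<le> (1 + A) * (?G x + ?G y)" for x y
  proof -
    have "A * (1 - \<theta> ^ (population x + population y)) \<le> A * (?G x + ?G y)"
      using A correction(2)[of "population x + population y"] G1[of x] G1[of y] by (intro mult_left_mono) auto
    thus ?thesis by (simp add: D_def algebra_simps)
  qed
  define \<kappa> where "\<kappa> = \<gamma> / (2 * (1 + A))"
  have \<kappa>: "0 < \<kappa>" using \<gamma> A by (simp add: \<kappa>_def)
  have drift_D: "?Q (\<lambda>x'. D x' y) x + ?Q (\<lambda>y'. D x y') y \<le> - \<kappa> * D x y"
    if xy: "(x, y) \<noteq> (0, 0)" for x y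
  proof -
    define n where "n = population x + population y"
    have "n \<noteq> 0" using xy by (auto simp: n_def population_0_iff)
    hence pow: "\<theta> ^ n = \<theta> * \<theta> ^ (n - 1)" by (cases n) auto
    define V where "V = ?G x + ?G y"
    have V: "0 < V" using G1[of x] G1[of y] by (simp add: V_def)
    have one: "?Q (\<lambda>x'. 1 - \<theta> ^ (population x' + population u)) v
        = (1 - \<theta>) * \<theta> ^ (n - 1) * (total_arrival * \<theta> - total_service v)"
      if uv: "population v + population u = n" for u v :: "nat ^ 'n"
    proof -
      have "?Q (\<lambda>x'. 1 - \<theta> ^ (population x' + population u)) v
          = total_arrival * (\<theta> ^ n - \<theta> ^ Suc n)
            + total_service v * (\<theta> ^ n - \<theta> ^ (population v - 1 + population u))"
        using generator_population[of "\<lambda>k. 1 - \<theta> ^ (k + population u)" v] uv by simp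
      also have "total_service v * (\<theta> ^ n - \<theta> ^ (population v - 1 + population u))
               = total_service v * (\<theta> ^ n - \<theta> ^ (n - 1))"
      proof (cases "v = 0")
        case True thus ?thesis by (simp add: \<phi>_empty)
      next
        case False
        hence "population v - 1 + population u = n - 1" using uv population_0_iff[of v] by simp
        thus ?thesis by simp
      qed
      finally show ?thesis using pow by (simp add: algebra_simps)
    qed
    have "?Q (\<lambda>x'. D x' y) x = ?Q ?G x + A * ?Q (\<lambda>x'. 1 - \<theta> ^ (population x' + population y)) x"
      unfolding D_def generator_add generator_cmult generator_const by simp
    moreover have "?Q (\<lambda>y'. D x y') y = ?Q ?G y + A * ?Q (\<lambda>y'. 1 - \<theta> ^ (population y' + population x)) y"
      unfolding D_def generator_add generator_cmult generator_const by (simp add: add.commute)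
    ultimately have "?Q (\<lambda>x'. D x' y) x + ?Q (\<lambda>y'. D x y') y
        = (?Q ?G x + ?Q ?G y) + A * ((1 - \<theta>) * \<theta> ^ (n - 1) *
            (2 * total_arrival * \<theta> - (total_service x + total_service y)))"
      using one[of x y] one[of y x] by (simp add: n_def algebra_simps)
    also have "\<dots> \<le> (- \<gamma> * V + 2 * b) + A * (- (\<theta> ^ (n - 1) * m / 4))"
    proof (rule add_mono[OF _ mult_left_mono[OF _ A]])
      show "?Q ?G x + ?Q ?G y \<le> - \<gamma> * V + 2 * b"
        using drift_G[of x] drift_G[of y] by (simp add: V_def algebra_simps)
      have "m \<le> total_service x + total_service y"
        using xy m(2)[of x] m(2)[of y] total_service_nonneg[of x] total_service_nonneg[of y]
        by (cases "x = 0") auto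
      hence le: "2 * total_arrival * \<theta> - (total_service x + total_service y) \<le> - (m / 2)"
        using \<theta>m by simp
      have "\<theta> ^ (n - 1) / 2 \<le> (1 - \<theta>) * \<theta> ^ (n - 1)"
        using mult_right_mono[of "1/2" "1 - \<theta>" "\<theta> ^ (n - 1)"] \<theta> by simp
      hence "(1 - \<theta>) * \<theta> ^ (n - 1) * (m / 2) \<ge> \<theta> ^ (n - 1) / 2 * (m / 2)"
        using m(1) by (intro mult_right_mono) auto
      moreover have "(1 - \<theta>) * \<theta> ^ (n - 1) * (2 * total_arrival * \<theta> - (total_service x + total_service y))
          \<le> (1 - \<theta>) * \<theta> ^ (n - 1) * (- (m / 2))"
        using le \<theta> by (intro mult_left_mono) auto
      ultimately show "(1 - \<theta>) * \<theta> ^ (n - 1) * (2 * total_arrival * \<theta> - (total_service x + total_service y))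
          \<le> - (\<theta> ^ (n - 1) * m / 4)" by linarith
    qed
    also have "\<dots> \<le> - (\<gamma> / 2) * V"
    proof (cases "4 * b / \<gamma> \<le> V")
      case True
      hence "2 * b \<le> \<gamma> / 2 * V" using \<gamma> by (simp add: field_simps)
      moreover have "0 \<le> A * (\<theta> ^ (n - 1) * m / 4)" using A \<theta> m(1) by simp
      ultimately show ?thesis by (simp add: algebra_simps)
    next
      case False
      hence xs: "x \<in> small" "y \<in> small" using G1[of x] G1[of y] by (auto simp: small_def V_def)
      have "population x \<le> (\<Sum>x\<in>small. population x)" "population y \<le> (\<Sum>x\<in>small. population x)"
        using xs small by (auto intro: member_le_sum)
      hence "n - 1 \<le> N" by (simp add: n_def N_def)
      hence pw: "\<theta> ^ N \<le> \<theta> ^ (n - 1)" using \<theta> by (intro power_decreasing) auto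
      have "2 * b = A * (\<theta> ^ N * m / 4)" using m(1) \<theta> by (simp add: A_def)
      also have "\<dots> \<le> A * (\<theta> ^ (n - 1) * m / 4)"
        using pw A m(1) by (intro mult_left_mono divide_right_mono mult_right_mono) auto
      finally have "2 * b \<le> A * (\<theta> ^ (n - 1) * m / 4)" .
      moreover have "0 \<le> \<gamma> * V" using \<gamma> V by simp
      ultimately show ?thesis by simp
    qed
    also have "\<dots> = - \<kappa> * ((1 + A) * V)" using A by (simp add: \<kappa>_def field_simps)
    also have "\<dots> \<le> - \<kappa> * D x y"
      using mult_left_mono[OF D_le[of x y], of \<kappa>] \<kappa> by (simp add: V_def)
    finally show ?thesis .
  qed
  have "finite {(x, y). D x y \<le> r}" for r
  proof (rule finite_subset)
    have "?G x \<le> r \<and> ?G y \<le> r" if "D x y \<le> r" for x y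
      using that D_ge[of x y] G1[of x] G1[of y] by linarith
    thus "{(x, y). D x y \<le> r} \<subseteq> {x. ?G x \<le> r} \<times> {x. ?G x \<le> r}" by auto
    show "finite ({x. ?G x \<le> r} \<times> {x. ?G x \<le> r})" using finite_G_sublevel[OF \<delta>] by blast
  qed
  moreover have "1 \<le> D x y" for x y using D_ge[of x y] G1[of x] G1[of y] by linarith
  ultimately show ?thesis using \<kappa> drift_D by blast
qed

end

section \<open>Proportional fairness\<close>

lemma interior_capacity_set:
  fixes C :: "(real ^ 'n) set"
  assumes "capacity_set C" "lam \<in> interior C"
  shows "0 < lam $ i" and "\<exists>\<epsilon>>0. (1 + \<epsilon>) *\<^sub>R lam \<in> C"
proof -
  obtain e where e: "e > 0" "ball lam e \<subseteq> C" using assms(2) by (auto simp: mem_interior)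
  have "lam - (e / 2) *\<^sub>R axis i 1 \<in> ball lam e" using e(1) by (simp add: dist_norm)
  hence "0 \<le> (lam - (e / 2) *\<^sub>R axis i 1) $ i" using e(2) assms(1) unfolding capacity_set_def by blast
  thus "0 < lam $ i" using e(1) by (simp add: axis_def)
  define \<epsilon> where "\<epsilon> = e / (norm lam + 1)"
  have d: "0 < norm lam + 1" by (simp add: add_nonneg_pos)
  have "\<epsilon> * norm lam < e" using e(1) d by (simp add: \<epsilon>_def field_simps)
  moreover have "lam - (1 + \<epsilon>) *\<^sub>R lam = - (\<epsilon> *\<^sub>R lam)" by (simp add: algebra_simps)
  moreover have "0 < \<epsilon>" using e(1) d by (simp add: \<epsilon>_def)
  ultimately have "(1 + \<epsilon>) *\<^sub>R lam \<in> ball lam e" by (simp add: dist_norm)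
  thus "\<exists>\<epsilon>>0. (1 + \<epsilon>) *\<^sub>R lam \<in> C" using e \<open>0 < \<epsilon>\<close> by blast
qed

lemma pf_objective_positive:
  assumes "\<And>i. 0 < x $ i \<Longrightarrow> 0 < \<eta> $ i"
  shows "pf_objective x \<eta> = ereal (\<Sum>i | 0 < x $ i. real (x $ i) * ln (\<eta> $ i))"
proof -
  have "pf_objective x \<eta> = (\<Sum>i | 0 < x $ i. ereal (real (x $ i) * ln (\<eta> $ i)))"
    unfolding pf_objective_def using assms by (intro sum.cong refl) (auto simp: elog_def)
  thus ?thesis by simp
qed

lemma pf_objective_minus_infinity:
  assumes "0 < x $ i" "\<not> 0 < \<eta> $ i"
  shows "pf_objective x \<eta> = - \<infinity>"
proof -
  have "(\<Sum>j\<in>{j. 0 < x $ j} - {i}. ereal (real (x $ j)) * elog (\<eta> $ j)) \<noteq> \<infinity>"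
    by (simp add: sum_Pinfty elog_def)
  moreover have "ereal (real (x $ i)) * elog (\<eta> $ i) = - \<infinity>" using assms by (simp add: elog_def)
  ultimately show ?thesis
    unfolding pf_objective_def using assms(1)
    by (subst sum.remove[of _ i]) auto
qed

text \<open>The exponential of the objective is a product of powers of the coordinates. Unlike the objective
  it is finite and continuous on the compact set \<open>C\<close>, so its maximum is attained. It is positive at
  \<open>\<zeta>\<close>, hence every served coordinate of a maximizer is positive.\<close>

lemma pf_maximizer:
  fixes C :: "(real ^ 'n) set" and x :: "nat ^ 'n"
  assumes C: "capacity_set C" and \<zeta>: "\<zeta> \<in> C" "\<And>i. 0 < \<zeta> $ i"
  defines "\<eta> \<equiv> arg_max (pf_objective x) (\<lambda>\<eta>. \<eta> \<in> C)"
  shows "\<eta> \<in> C" and "\<And>\<xi>. \<xi> \<in> C \<Longrightarrow> pf_objective x \<xi> \<le> pf_objective x \<eta>"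
    and "\<And>i. 0 < x $ i \<Longrightarrow> 0 < \<eta> $ i"
proof -
  define p where "p \<xi> = (\<Prod>i\<in>UNIV. (\<xi> $ i) ^ (x $ i))" for \<xi> :: "real ^ 'n"
  have "compact C" "C \<noteq> {}" using C \<zeta> by (auto simp: capacity_set_def)
  moreover have "continuous_on C p" unfolding p_def by (intro continuous_intros)
  ultimately obtain m where m: "m \<in> C" "\<And>\<xi>. \<xi> \<in> C \<Longrightarrow> p \<xi> \<le> p m"
    using continuous_attains_sup by metis
  have nonneg: "0 \<le> \<xi> $ i" if "\<xi> \<in> C" for \<xi> i using C that by (auto simp: capacity_set_def)
  have p_pos: "0 < p \<xi> \<longleftrightarrow> (\<forall>i. 0 < x $ i \<longrightarrow> 0 < \<xi> $ i)" if "\<xi> \<in> C" for \<xi>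
  proof
    assume "0 < p \<xi>"
    hence "p \<xi> \<noteq> 0" by simp
    hence "(\<xi> $ i) ^ (x $ i) \<noteq> 0" for i unfolding p_def prod_zero_iff[OF finite] by blast
    thus "\<forall>i. 0 < x $ i \<longrightarrow> 0 < \<xi> $ i" using nonneg[OF that] by (metis less_le power_eq_0_iff)
  next
    assume *: "\<forall>i. 0 < x $ i \<longrightarrow> 0 < \<xi> $ i"
    have "0 < (\<xi> $ i) ^ (x $ i)" for i using * by (cases "x $ i = 0") auto
    thus "0 < p \<xi>" unfolding p_def by (intro prod_pos)
  qed
  have obj: "pf_objective x \<xi> = ereal (ln (p \<xi>))" if "\<xi> \<in> C" "0 < p \<xi>" for \<xi>
  proof -
    have pos: "0 < \<xi> $ i" if "0 < x $ i" for i using p_pos \<open>\<xi> \<in> C\<close> \<open>0 < p \<xi>\<close> that by blast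
    have "(\<Sum>i | 0 < x $ i. real (x $ i) * ln (\<xi> $ i)) = (\<Sum>i\<in>UNIV. ln ((\<xi> $ i) ^ (x $ i)))"
      using pos by (intro sum.mono_neutral_cong_left) (auto simp: ln_realpow)
    also have "\<dots> = ln (p \<xi>)"
    proof -
      have "(\<xi> $ i) ^ (x $ i) \<noteq> 0" for i using pos[of i] by (cases "x $ i = 0") auto
      thus ?thesis unfolding p_def by (intro ln_prod[symmetric] finite)
    qed
    finally show ?thesis using pf_objective_positive[of x \<xi>] pos by simp
  qed
  have "0 < p \<zeta>" using p_pos[OF \<zeta>(1)] \<zeta>(2) by simp
  hence pm: "0 < p m" using m(2)[OF \<zeta>(1)] by simp
  have max_m: "pf_objective x \<xi> \<le> pf_objective x m" if \<xi>: "\<xi> \<in> C" for \<xi>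
  proof (cases "0 < p \<xi>")
    case True
    thus ?thesis using m(2)[OF \<xi>] by (simp add: obj[OF \<xi>] obj[OF m(1) pm])
  next
    case False
    then obtain i where "0 < x $ i" "\<not> 0 < \<xi> $ i" using p_pos[OF \<xi>] by blast
    thus ?thesis by (simp add: pf_objective_minus_infinity)
  qed
  have "is_arg_max (pf_objective x) (\<lambda>\<eta>. \<eta> \<in> C) m"
    using m max_m by (auto simp: is_arg_max_def not_less)
  hence "is_arg_max (pf_objective x) (\<lambda>\<eta>. \<eta> \<in> C) \<eta>"
    unfolding \<eta>_def arg_max_def by (rule someI)
  thus \<eta>: "\<eta> \<in> C" and max: "\<And>\<xi>. \<xi> \<in> C \<Longrightarrow> pf_objective x \<xi> \<le> pf_objective x \<eta>"
    by (auto simp: is_arg_max_def not_less)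
  show "0 < \<eta> $ i" if "0 < x $ i" for i
    using max[OF m(1)] pf_objective_minus_infinity[OF that, of \<eta>] by (cases "0 < \<eta> $ i") (auto simp: obj[OF m(1) pm])
qed

text \<open>First order optimality: along the segment from the maximizer \<open>\<eta>\<close> to a feasible point \<open>\<zeta>\<close>, the
  objective has derivative \<open>(\<Sum>i. x i (\<zeta> i - \<eta> i) / \<eta> i)\<close> at \<open>\<eta>\<close>, which cannot be positive.\<close>

lemma pf_first_order:
  fixes C :: "(real ^ 'n) set" and x :: "nat ^ 'n"
  assumes C: "capacity_set C" and \<zeta>: "\<zeta> \<in> C" "\<And>i. 0 < \<zeta> $ i"
  shows "(\<Sum>i\<in>UNIV. real (x $ i) * \<zeta> $ i / pf_alloc C x $ i) \<le> real (population x)"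
proof -
  define \<eta> where "\<eta> = arg_max (pf_objective x) (\<lambda>\<eta>. \<eta> \<in> C)"
  note max = pf_maximizer[OF C \<zeta>, where x = x, folded \<eta>_def]
  define I where "I = {i. 0 < x $ i}"
  define h where "h t = (\<Sum>i\<in>I. real (x $ i) * ln (\<eta> $ i + t * (\<zeta> $ i - \<eta> $ i)))" for t
  define d where "d = (\<Sum>i\<in>I. real (x $ i) * ((\<zeta> $ i - \<eta> $ i) / \<eta> $ i))"
  have pos: "0 < \<eta> $ i" if "i \<in> I" for i using max(3) that by (simp add: I_def)
  have der: "(h has_real_derivative d) (at 0)"
    unfolding h_def d_def using pos by (auto intro!: derivative_eq_intros sum.cong)
  have le: "h t \<le> h 0" if t: "0 \<le> t" "t \<le> 1" for t
  proof -
    define \<xi> where "\<xi> = (1 - t) *\<^sub>R \<eta> + t *\<^sub>R \<zeta>"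
    have \<xi>: "\<xi> \<in> C" using C max(1) \<zeta>(1) t unfolding capacity_set_def \<xi>_def by (intro convexD_alt) auto
    have comp: "\<xi> $ i = \<eta> $ i + t * (\<zeta> $ i - \<eta> $ i)" for i by (simp add: \<xi>_def algebra_simps)
    have "0 < \<xi> $ i" if "0 < x $ i" for i
    proof (cases "t = 0")
      case True thus ?thesis using pos[of i] that by (simp add: comp I_def)
    next
      case False
      hence "0 < t * \<zeta> $ i" using t \<zeta>(2) by simp
      moreover have "0 \<le> (1 - t) * \<eta> $ i" using pos[of i] that t by (simp add: I_def less_imp_le)
      ultimately show ?thesis unfolding \<xi>_def vector_add_component vector_scaleR_component real_scaleR_def
        by (rule add_nonneg_pos[rotated])
    qed
    thus ?thesis
      using max(2)[OF \<xi>] pf_objective_positive[of x \<xi>] pf_objective_positive[of x \<eta>] max(3)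
      by (simp add: h_def I_def comp)
  qed
  have "d \<le> 0"
  proof (rule ccontr)
    assume "\<not> d \<le> 0"
    then obtain r where r: "r > 0" "\<And>s. 0 < s \<Longrightarrow> s < r \<Longrightarrow> h 0 < h (0 + s)"
      using DERIV_pos_inc_right[OF der] by auto
    have "h 0 < h (min 1 (r / 2))" using r(2)[of "min 1 (r/2)"] r(1) by (simp add: min_def split: if_splits)
    thus False using le[of "min 1 (r / 2)"] r(1) by simp
  qed
  moreover have "d = (\<Sum>i\<in>I. real (x $ i) * \<zeta> $ i / \<eta> $ i) - (\<Sum>i\<in>I. real (x $ i))"
    unfolding d_def sum_subtractf[symmetric]
  proof (rule sum.cong[OF refl])
    fix i assume "i \<in> I"
    thus "real (x $ i) * ((\<zeta> $ i - \<eta> $ i) / \<eta> $ i) = real (x $ i) * \<zeta> $ i / \<eta> $ i - real (x $ i)"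
      using pos[of i] by (simp add: diff_divide_distrib right_diff_distrib)
  qed
  moreover have "(\<Sum>i\<in>I. real (x $ i)) = real (population x)"
    unfolding population_def of_nat_sum by (rule sum.mono_neutral_left) (auto simp: I_def)
  moreover have "(\<Sum>i\<in>I. real (x $ i) * \<zeta> $ i / \<eta> $ i) = (\<Sum>i\<in>UNIV. real (x $ i) * \<zeta> $ i / pf_alloc C x $ i)"
    by (rule sum.mono_neutral_cong_left) (auto simp: I_def pf_alloc_def \<eta>_def)
  ultimately show ?thesis by linarith
qed

text \<open>With \<open>a = 1 + \<epsilon>\<close> such that \<open>\<zeta> = a \<lambda>\<close> is feasible, and \<open>r = \<phi> i / \<lambda> i\<close>, expanding the square of
  \<open>r - a\<close> gives \<open>r \<ge> 2 a - a\<^sup>2 / r\<close>. Weighting with \<open>x i\<close> and summing, the last term is at most \<open>a\<close>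
  times the population by first order optimality for \<open>\<zeta>\<close>.\<close>

lemma stable_network_pf_alloc:
  fixes C :: "(real ^ 'n) set"
  assumes C: "capacity_set C" and lam: "lam \<in> interior C"
  shows "\<exists>\<epsilon> B. stable_network lam (pf_alloc C) \<epsilon> B"
proof -
  note lam_pos = interior_capacity_set(1)[OF C lam]
  obtain \<epsilon> where \<epsilon>: "0 < \<epsilon>" "(1 + \<epsilon>) *\<^sub>R lam \<in> C" using interior_capacity_set(2)[OF C lam] by blast
  define \<zeta> where "\<zeta> = (1 + \<epsilon>) *\<^sub>R lam"
  have \<zeta>: "\<zeta> \<in> C" "\<And>i. 0 < \<zeta> $ i" using \<epsilon> lam_pos by (auto simp: \<zeta>_def)
  obtain B where B: "\<And>\<eta>. \<eta> \<in> C \<Longrightarrow> norm \<eta> \<le> B"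
    using C by (auto simp: capacity_set_def compact_eq_bounded_closed bounded_iff)
  have B0: "0 \<le> B" using order_trans[OF norm_ge_zero B[OF \<zeta>(1)]] .
  have pos: "0 < pf_alloc C x $ i" if "x $ i \<noteq> 0" for x i
    using pf_maximizer(3)[OF C \<zeta>, where x = x and i = i] that by (simp add: pf_alloc_def)
  have "stable_network lam (pf_alloc C) \<epsilon> B"
  proof
    show "0 < lam $ i" for i by (rule lam_pos)
    show empty: "pf_alloc C x $ i = 0" if "x $ i = 0" for x i using that by (simp add: pf_alloc_def)
    show "0 \<le> pf_alloc C x $ i" for x i using pos[of x i] empty[of x i] by (cases "x $ i = 0") auto
    show "pf_alloc C x $ i \<le> B" for x i
    proof -
      define \<eta> where "\<eta> = arg_max (pf_objective x) (\<lambda>\<eta>. \<eta> \<in> C)"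
      have "norm \<eta> \<le> B" unfolding \<eta>_def by (intro B pf_maximizer(1)[OF C \<zeta>])
      hence "\<eta> $ i \<le> B" using component_le_norm_cart[of \<eta> i] by simp
      thus ?thesis using B0 by (simp add: pf_alloc_def \<eta>_def)
    qed
    show "0 < \<epsilon>" by (rule \<epsilon>)
    show "(1 + \<epsilon>) * real (population x) \<le> (\<Sum>i\<in>UNIV. real (x $ i) * pf_alloc C x $ i / lam $ i)" for x
    proof -
      have "2 * (1 + \<epsilon>) * real (x $ i) - (1 + \<epsilon>) * (real (x $ i) * \<zeta> $ i / pf_alloc C x $ i)
          \<le> real (x $ i) * pf_alloc C x $ i / lam $ i" for i
      proof (cases "x $ i = 0")
        case False
        define r where "r = pf_alloc C x $ i / lam $ i"
        have r: "0 < r" using pos[OF False] lam_pos[of i] by (simp add: r_def)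
        have "2 * (1 + \<epsilon>) * r - (1 + \<epsilon>)\<^sup>2 \<le> r * r"
          using zero_le_power2[of "r - (1 + \<epsilon>)"] by (simp add: power2_eq_square algebra_simps)
        hence "2 * (1 + \<epsilon>) - (1 + \<epsilon>)\<^sup>2 / r \<le> r" using r by (simp add: field_simps)
        hence "real (x $ i) * (2 * (1 + \<epsilon>) - (1 + \<epsilon>)\<^sup>2 / r) \<le> real (x $ i) * r" by (rule mult_left_mono) simp
        thus ?thesis by (simp add: r_def \<zeta>_def power2_eq_square algebra_simps)
      qed simp
      hence "(\<Sum>i\<in>UNIV. 2 * (1 + \<epsilon>) * real (x $ i) - (1 + \<epsilon>) * (real (x $ i) * \<zeta> $ i / pf_alloc C x $ i))
          \<le> (\<Sum>i\<in>UNIV. real (x $ i) * pf_alloc C x $ i / lam $ i)" by (rule sum_mono)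
      moreover have "(\<Sum>i\<in>UNIV. 2 * (1 + \<epsilon>) * real (x $ i) - (1 + \<epsilon>) * (real (x $ i) * \<zeta> $ i / pf_alloc C x $ i))
          = 2 * (1 + \<epsilon>) * real (population x) - (1 + \<epsilon>) * (\<Sum>i\<in>UNIV. real (x $ i) * \<zeta> $ i / pf_alloc C x $ i)"
        by (simp only: sum_subtractf sum_distrib_left[symmetric] population_def of_nat_sum)
      moreover have "(1 + \<epsilon>) * (\<Sum>i\<in>UNIV. real (x $ i) * \<zeta> $ i / pf_alloc C x $ i) \<le> (1 + \<epsilon>) * real (population x)"
        using pf_first_order[OF C \<zeta>, of x] \<epsilon> by (intro mult_left_mono) auto
      ultimately show ?thesis by linarith
    qed
  qed
  thus ?thesis by blast
qed

section \<open>Exponential drift and exponential convergence to equilibrium\<close>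

theorem proposition5:
  fixes C :: "(real ^ 'n) set" and lam :: "real ^ 'n"
  assumes "capacity_set C" and "lam \<in> interior C"
  shows "(\<exists>\<delta>>0. \<exists>\<gamma>>0. \<exists>K::real. \<forall>x :: nat ^ 'n. real (\<Sum>i\<in>UNIV. x $ i) > K \<longrightarrow>
            generator lam (pf_alloc C) (G_fun lam \<delta>) x \<le> - \<gamma> * G_fun lam \<delta> x) \<and>
         (\<forall>(P :: nat ^ 'n \<Rightarrow> 'w measure) X.
            continuous_time_markov_process P X (network_rate lam (pf_alloc C)) \<longrightarrow>
            (\<exists>\<pi>. stationary_distribution P X \<pi> \<and>
                 (\<forall>\<pi>'. stationary_distribution P X \<pi>' \<longrightarrow> \<pi>' = \<pi>) \<and>
                 (\<exists>K1>0. \<exists>K2>0. \<forall>x. \<forall>t\<ge>0.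
                    \<bar>trans_prob P X t 0 x - \<pi> x\<bar> \<le> K1 * exp (- K2 * t))))"
proof -
  obtain \<epsilon> B where "stable_network lam (pf_alloc C) \<epsilon> B"
    using stable_network_pf_alloc[OF assms] by blast
  then interpret stable_network lam "pf_alloc C" \<epsilon> B .
  obtain D :: "nat ^ 'n \<Rightarrow> nat ^ 'n \<Rightarrow> real" and \<kappa> where
    D: "0 < \<kappa>" "\<And>x y. 1 \<le> D x y" "\<And>r. finite {(x, y). D x y \<le> r}" and
    drift: "\<And>x y. (x, y) \<noteq> (0, 0) \<Longrightarrow>
        generator lam (pf_alloc C) (\<lambda>x'. D x' y) x + generator lam (pf_alloc C) (\<lambda>y'. D x y') y \<le> - \<kappa> * D x y"
    using pair_lyapunov_function by metis
  have rate: "finite {y. network_rate lam (pf_alloc C) x y \<noteq> 0}"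
      "jump_generator (network_rate lam (pf_alloc C)) f x = generator lam (pf_alloc C) f x" for f x
    by (rule jump_generator_network_rate; erule \<phi>_empty)+
  have "\<exists>\<pi>. stationary_distribution P X \<pi> \<and>
          (\<forall>\<pi>'. stationary_distribution P X \<pi>' \<longrightarrow> \<pi>' = \<pi>) \<and>
          (\<exists>K1>0. \<exists>K2>0. \<forall>x. \<forall>t\<ge>0. \<bar>trans_prob P X t 0 x - \<pi> x\<bar> \<le> K1 * exp (- K2 * t))"
    if "continuous_time_markov_process P X (network_rate lam (pf_alloc C))"
    for P :: "nat ^ 'n \<Rightarrow> 'w measure" and X
  proof (rule continuous_time_markov_process.exponential_ergodicity[OF that, where D = D and \<kappa> = \<kappa>])
    show "0 \<le> D x y" for x y using D(2)[of x y] by simp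
    show "jump_generator (network_rate lam (pf_alloc C)) (\<lambda>x'. D x' y) x
            + jump_generator (network_rate lam (pf_alloc C)) (\<lambda>y'. D x y') y \<le> - \<kappa> * D x y"
      if "(x, y) \<noteq> (0, 0)" for x y
      unfolding rate using that by (rule drift)
  qed (simp_all add: rate D)
  with exponential_drift show ?thesis unfolding population_def by blast
qed

end
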